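(* Assume that $m$ is prime. Let $\mathcal{C}$ be a completely decomposable $[n,k]_{q^m/q}$ code of type $(n_1,\ldots,n_k)$. Let $n_k=\ldots=n_{k-\ell}\neq n_{k-\ell-1}$, for some $\ell\in\{1,\ldots,k-1\}$, with $n_0:=0$. Then $$A_{n_k}(\mathcal{C})=(q^m-1)\frac{q^{\ell+1}-1}{q-1}$$ if and only if, up to equivalence (that is, after replacing $\mathcal{C}$ by a suitable equivalent code with a generator matrix in a weight complementary form), we have $$\Pi(\mathcal{C},k-\ell)=\underbrace{\mathcal{C}'\oplus\ldots\oplus\mathcal{C}'}_{\ell+1},$$ with $\mathcal{C}'=\langle\mathbf{u}\rangle_{\mathbb{F}_{q^m}}$, for some $\mathbf{u}=(u_1,\ldots,u_{n_k})\in\mathbb{F}_{q^m}^{n_k}$, where $\mathrm{w}(\mathbf{u})=n_k$ and $\dim_{\mathbb{F}_q}(U^{\perp^*}U)=m-1$, with $U=\langle u_1,\ldots,u_{n_k}\rangle_{\mathbb{F}_q}$.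
   Context: Let $q$ be a prime power. The rank weight (here: weight) of $\mathbf{v}\in\mathbb{F}_{q^m}^n$ is the $\mathbb{F}_q$-dimension $\mathrm{w}(\mathbf{v})$ of the $\mathbb{F}_q$-span of its entries. $A_i(\mathcal{C})$ is the number of codewords of $\mathcal{C}$ of weight $i$. An $[n,k]_{q^m/q}$ code is a $k$-dimensional $\mathbb{F}_{q^m}$-subspace $\mathcal{C}$ of $\mathbb{F}_{q^m}^n$; a generator matrix is $G\in\mathbb{F}_{q^m}^{k\times n}$ with $\mathcal{C}=\{\mathbf{x}G:\mathbf{x}\in\mathbb{F}_{q^m}^k\}$. Two codes in $\mathbb{F}_{q^m}^n$ are equivalent if one is obtained from the other by right multiplication by some $A\in\mathrm{GL}(n,q)$. The (external) direct sum of codes $\mathcal{C}_i\subseteq\mathbb{F}_{q^m}^{n_i}$, $i=1,\ldots,s$, is $\{(\mathbf{c}_1,\ldots,\mathbf{c}_s):\mathbf{c}_i\in\mathcal{C}_i\}\subseteq\mathbb{F}_{q^m}^{n_1+\ldots+n_s}$. For integers $m>n_1\geq\ldots\geq n_k\geq1$, an $[n,k]_{q^m/q}$ code is completely decomposable of type $(n_1,\ldots,n_k)$ if $n=n_1+\ldots+n_k$ and it is equivalent to a code having a block-diagonal generator matrix $\mathbf{u}_1\oplus\ldots\oplus\mathbf{u}_k$ with $\mathbf{u}_i\in\mathbb{F}_{q^m}^{1\times n_i}$ and $\mathrm{w}(\mathbf{u}_i)=n_i$ for each $i$. A generator matrix of this block-diagonal form is said to be in a weight complementary form. For a code $\mathcal{C}$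 with such a generator matrix and $t\in\{1,\ldots,k\}$, the $t$-punctured code is $\Pi(\mathcal{C},t)=\{(\alpha_t\mathbf{u}_t,\ldots,\alpha_k\mathbf{u}_k):\alpha_i\in\mathbb{F}_{q^m}\}\subseteq\mathbb{F}_{q^m}^{n_t+\ldots+n_k}$. For an $\mathbb{F}_q$-subspace $W\subseteq\mathbb{F}_{q^m}$, $W^{\perp^*}=\{b\in\mathbb{F}_{q^m}:\mathrm{Tr}_{q^m/q}(ab)=0\ \forall a\in W\}$, with $\mathrm{Tr}_{q^m/q}$ the trace from $\mathbb{F}_{q^m}$ to $\mathbb{F}_q$. For $\mathbb{F}_q$-subspaces $U,V\subseteq\mathbb{F}_{q^m}$, $UV$ denotes the $\mathbb{F}_q$-span of $\{ab:a\in U,b\in V\}$. *)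

theory Defs
  imports
    "Jordan_Normal_Form.VS_Connect"
    "HOL-Library.Cardinality"
    "HOL-Computational_Algebra.Primes"
begin

text \<open>
  The extension of finite fields is given by two finite field types \<open>'f\<close> (of order \<open>q\<close>)
  and \<open>'e\<close> (of order \<open>q ^ m\<close>) together with a field homomorphism \<open>emb\<close> from \<open>'f\<close> to \<open>'e\<close>,
  which makes \<open>'e\<close> a vector space over \<open>'f\<close>.
\<close>

definition ext_scale :: "('f :: field \<Rightarrow> 'e :: field) \<Rightarrow> 'f \<Rightarrow> 'e \<Rightarrow> 'e" where
  "ext_scale emb c x = emb c * x"

definition ext_span :: "('f :: field \<Rightarrow> 'e :: field) \<Rightarrow> 'e set \<Rightarrow> 'e set" where
  "ext_span emb = Modules.module.span (ext_scale emb)"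

text \<open>By the library convention this is the dimension of the span of its argument.\<close>

definition ext_dim :: "('f :: field \<Rightarrow> 'e :: field) \<Rightarrow> 'e set \<Rightarrow> nat" where
  "ext_dim emb = Vector_Spaces.vector_space.dim (ext_scale emb)"

definition field_trace :: "nat \<Rightarrow> nat \<Rightarrow> 'e :: field \<Rightarrow> 'e" where
  "field_trace q m x = (\<Sum>i<m. x ^ (q ^ i))"

definition trace_perp :: "nat \<Rightarrow> nat \<Rightarrow> 'e :: field set \<Rightarrow> 'e set" where
  "trace_perp q m W = {b. \<forall>a\<in>W. field_trace q m (a * b) = 0}"

definition space_prod :: "('f :: field \<Rightarrow> 'e :: field) \<Rightarrow> 'e set \<Rightarrow> 'e set \<Rightarrow> 'e set" where
  "space_prod emb U V = ext_span emb {a * b | a b. a \<in> U \<and> b \<in> V}"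

definition rank_weight :: "('f :: field \<Rightarrow> 'e :: field) \<Rightarrow> 'e vec \<Rightarrow> nat" where
  "rank_weight emb v = ext_dim emb (ext_span emb (set\<^sub>v v))"

definition weight_count :: "('f :: field \<Rightarrow> 'e :: field) \<Rightarrow> nat \<Rightarrow> 'e vec set \<Rightarrow> nat" where
  "weight_count emb i C = card {c \<in> C. rank_weight emb c = i}"

definition is_code :: "nat \<Rightarrow> nat \<Rightarrow> 'e :: field vec set \<Rightarrow> bool" where
  "is_code n k C \<longleftrightarrow>
     VectorSpace.subspace class_ring C (module_vec TYPE('e) n) \<and>
     vectorspace.dim class_ring ((module_vec TYPE('e) n)\<lparr>carrier := C\<rparr>) = k"

text \<open>Row vector times matrix; the library only has matrix times column vector.\<close>

definition row_mult :: "'e :: field vec \<Rightarrow> 'e mat \<Rightarrow> 'e vec" where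
  "row_mult x G = G\<^sup>T *\<^sub>v x"

definition generator_matrix :: "nat \<Rightarrow> nat \<Rightarrow> 'e :: field vec set \<Rightarrow> 'e mat \<Rightarrow> bool" where
  "generator_matrix n k C G \<longleftrightarrow>
     is_code n k C \<and> G \<in> carrier_mat k n \<and> C = {row_mult x G | x. x \<in> carrier_vec k}"

definition code_equiv ::
    "('f :: field \<Rightarrow> 'e :: field) \<Rightarrow> nat \<Rightarrow> 'e vec set \<Rightarrow> 'e vec set \<Rightarrow> bool" where
  "code_equiv emb n C D \<longleftrightarrow>
     (\<exists>A \<in> carrier_mat n n. invertible_mat A \<and> D = (\<lambda>c. row_mult c (map_mat emb A)) ` C)"

definition concat_vec :: "'e :: field vec list \<Rightarrow> 'e vec" where
  "concat_vec vs = foldr (@\<^sub>v) vs vNil"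

definition code_direct_sum :: "'e :: field vec set list \<Rightarrow> 'e vec set" where
  "code_direct_sum Cs = {concat_vec cs | cs. list_all2 (\<in>) cs Cs}"

definition line_code :: "'e :: field vec \<Rightarrow> 'e vec set" where
  "line_code u = {a \<cdot>\<^sub>v u | a. True}"

text \<open>
  The blocks \<open>us 1, \<dots>, us k\<close> and the lengths \<open>nn 1, \<dots>, nn k\<close> are indexed from 1.
\<close>

definition block_matrix :: "nat \<Rightarrow> (nat \<Rightarrow> 'e :: field vec) \<Rightarrow> 'e mat" where
  "block_matrix k us = diag_block_mat (map (\<lambda>i. mat_of_row (us i)) [1..<k+1])"

definition weight_complementary ::
    "('f :: field \<Rightarrow> 'e :: field) \<Rightarrow> nat \<Rightarrow> nat \<Rightarrow> (nat \<Rightarrow> nat) \<Rightarrow> 'e vec set \<Rightarrow> (nat \<Rightarrow> 'e vec) \<Rightarrow> bool"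
where
  "weight_complementary emb n k nn C us \<longleftrightarrow>
     generator_matrix n k C (block_matrix k us) \<and>
     (\<forall>i\<in>{1..k}. us i \<in> carrier_vec (nn i) \<and> rank_weight emb (us i) = nn i)"

definition completely_decomposable ::
    "('f :: field \<Rightarrow> 'e :: field) \<Rightarrow> nat \<Rightarrow> nat \<Rightarrow> nat \<Rightarrow> (nat \<Rightarrow> nat) \<Rightarrow> 'e vec set \<Rightarrow> bool" where
  "completely_decomposable emb m n k nn C \<longleftrightarrow>
     is_code n k C \<and>
     (\<forall>i\<in>{1..k}. 1 \<le> nn i \<and> nn i < m) \<and>
     (\<forall>i\<in>{1..<k}. nn (i + 1) \<le> nn i) \<and>
     n = (\<Sum>i=1..k. nn i) \<and>
     (\<exists>D us. code_equiv emb n C D \<and> weight_complementary emb n k nn D us)"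

text \<open>
  The punctured code is computed from the blocks \<open>us\<close> of a weight complementary generator
  matrix; the code and the lengths of the blocks determine each block up to a scalar,
  so it does not depend on their choice.
\<close>

definition punctured :: "nat \<Rightarrow> (nat \<Rightarrow> 'e :: field vec) \<Rightarrow> nat \<Rightarrow> 'e vec set" where
  "punctured k us t = {concat_vec (map (\<lambda>i. a i \<cdot>\<^sub>v us i) [t..<k+1]) | a. True}"

end

theory Submission
  imports Defs "HOL-Computational_Algebra.Polynomial"
begin

text \<open>
  A nonzero word \<open>(a\<^sub>1 u\<^sub>1, \<dots>, a\<^sub>k u\<^sub>k)\<close> has the minimal weight \<open>n\<^sub>k\<close> exactly when \<open>a\<^sub>i = 0\<close> for all \<open>i < k - l\<close> and
  the spaces \<open>a\<^sub>i U\<^sub>i\<close> with \<open>a\<^sub>i \<noteq> 0\<close> coincide, where \<open>U\<^sub>i\<close> is the span of the entries of \<open>u\<^sub>i\<close>. The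
  multipliers that map a proper nonzero subspace into itself form an intermediate field, which is
  the ground field because the degree \<open>m\<close> is prime. So, once the last nonzero coefficient is fixed,
  every earlier one has \<open>q\<close> choices if the two spaces are multiples of each other and only the
  choice \<open>0\<close> otherwise; the count is maximal iff all the spaces \<open>U\<^sub>i\<close>, \<open>i \<ge> k - l\<close>, are multiples
  of \<open>U\<^sub>k\<close>. A change of basis over the ground field in each block turns this into the
  splitting of the punctured code. The condition on \<open>U\<^sup>\<bottom> U\<close> then holds automatically, because the
  orthogonal space of \<open>U\<^sup>\<bottom> U\<close> is again the field of multipliers of \<open>U\<close>.
\<close>

subsection \<open>Trace duality in extensions of finite fields\<close>

lemma power_card_mult_closed:
  fixes S :: "'a :: field set"
  assumes fin: "finite S" and zero: "0 \<in> S"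
    and mult: "\<And>x y. x \<in> S \<Longrightarrow> y \<in> S \<Longrightarrow> x * y \<in> S" and x: "x \<in> S"
  shows "x ^ card S = x"
proof (cases "x = 0")
  case True
  have "card S > 0" using fin zero by (auto simp: card_gt_0_iff)
  then show ?thesis using True by simp
next
  case False
  let ?T = "S - {0}"
  have finT: "finite ?T" using fin by simp
  have inj: "inj_on ((*) x) ?T" using False by (auto simp: inj_on_def)
  have sub: "(*) x ` ?T \<subseteq> ?T" using mult x False by auto
  have im: "(*) x ` ?T = ?T" using endo_inj_surj[OF finT sub inj] .
  have "\<Prod>?T = prod id ((*) x ` ?T)" using im by simp
  also have "\<dots> = (\<Prod>y\<in>?T. x * y)" using prod.reindex[OF inj, of id] by simp
  also have "\<dots> = x ^ card ?T * \<Prod>?T" by (simp add: prod.distrib)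
  finally have "x ^ card ?T = 1" using finT by simp
  moreover have "card S = Suc (card ?T)" using fin zero by (metis card_Suc_Diff1)
  ultimately show ?thesis by simp
qed

lemma finite_field_power_card:
  fixes x :: "'a :: {field, finite}"
  shows "x ^ CARD('a) = x"
  by (rule power_card_mult_closed) auto

lemma card_field_ge_2: "2 \<le> CARD('a :: {field, finite})"
proof -
  have "card {0, 1 :: 'a} \<le> CARD('a)" by (rule card_mono) auto
  then show ?thesis by simp
qed

text \<open>Since \<open>x ^ q = x\<close> for all \<open>x\<close>, both \<open>(x + 1) ^ q\<close>
  and \<open>x ^ q + 1\<close> equal \<open>x + 1\<close>. The inner binomial terms therefore form a
  polynomial of degree below \<open>q\<close> that vanishes at all \<open>q\<close> elements, so its
  coefficients are zero.\<close>

lemma finite_field_binomial_eq_0: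
  assumes i: "0 < i" "i < CARD('a :: {field, finite})"
  shows "of_nat (CARD('a) choose i) = (0 :: 'a)"
proof -
  define q where "q = CARD('a)"
  define p where "p = (\<Sum>i\<in>{1..<q}. monom (of_nat (q choose i) :: 'a) i)"
  have root: "poly p x = 0" for x
  proof -
    have "(\<Sum>i\<le>q. of_nat (q choose i) * x ^ i) = (x + 1) ^ q"
      by (simp add: binomial_ring)
    also have "\<dots> = x ^ q + 1"
      unfolding q_def by (simp add: finite_field_power_card)
    finally have "(\<Sum>i\<le>q. of_nat (q choose i) * x ^ i) = x ^ q + 1" .
    moreover have "{..q} = insert 0 (insert q {1..<q})" using i by (auto simp: q_def)
    then have "(\<Sum>i\<le>q. of_nat (q choose i) * x ^ i) =
        1 + (x ^ q + (\<Sum>i\<in>{1..<q}. of_nat (q choose i) * x ^ i))"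
      using i by (simp add: q_def)
    ultimately have "(\<Sum>i\<in>{1..<q}. of_nat (q choose i) * x ^ i) = 0" by simp
    then show ?thesis by (simp add: p_def poly_sum poly_monom)
  qed
  have deg: "degree p < q"
    unfolding p_def using i
    by (intro le_less_trans[OF degree_sum_le[where n = "q - 1"]])
       (auto intro!: degree_monom_le[THEN order_trans] simp: q_def)
  have "p = 0"
  proof (rule ccontr)
    assume "p \<noteq> 0"
    then have "card {x. poly p x = 0} \<le> degree p" by (rule card_poly_roots_bound)
    then show False using root deg by (simp add: q_def)
  qed
  moreover have "coeff p i = of_nat (q choose i)"
    using i by (simp add: p_def coeff_sum q_def)
  ultimately show ?thesis by (simp add: q_def)
qed

section \<open>Subspaces over the ground field, measured by their cardinality\<close>

locale field_ext = field_hom emb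
  for emb :: "'f :: {field, finite} \<Rightarrow> 'e :: {field, finite}" +
  fixes m :: nat
  assumes card_ext: "CARD('e) = CARD('f) ^ m"
begin

lemma q_ge_2: "2 \<le> CARD('f)"
  by (rule card_field_ge_2)

sublocale E: vector_space "ext_scale emb"
  rewrites "module.span (ext_scale emb) = ext_span emb"
    and "vector_space.dim (ext_scale emb) = ext_dim emb"
proof -
  show "vector_space (ext_scale emb)"
    by unfold_locales (auto simp: ext_scale_def algebra_simps hom_distribs)
qed (auto simp: ext_span_def ext_dim_def)

lemma m_pos: "0 < m"
  using card_ext card_field_ge_2[where 'a='e] by (cases m) auto

text \<open>Counts coordinate functions. From here on dimensions are mostly compared through
  cardinalities, so that subspaces of equal dimension can be identified by finite counting.\<close>

lemma card_span_independent:
  assumes "E.independent B"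
  shows "card (ext_span emb B) = CARD('f) ^ card B"
proof -
  have fin: "finite B" by simp
  \<comment> \<open>Extensional functions have a fixed value outside \<open>B\<close>; without this
    the coordinates of a vector would not be unique.\<close>
  have "ext_span emb B = (\<lambda>c. \<Sum>v\<in>B. ext_scale emb (c v) v) ` (B \<rightarrow>\<^sub>E UNIV)"
  proof safe
    fix x assume "x \<in> ext_span emb B"
    then obtain c where c: "x = (\<Sum>v\<in>B. ext_scale emb (c v) v)"
      using E.span_finite[OF fin] by auto
    then have "x = (\<Sum>v\<in>B. ext_scale emb (restrict c B v) v)" by simp
    then show "x \<in> (\<lambda>c. \<Sum>v\<in>B. ext_scale emb (c v) v) ` (B \<rightarrow>\<^sub>E UNIV)"
      by (intro image_eqI[where x = "restrict c B"]) auto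
  next
    fix c :: "'e \<Rightarrow> 'f"
    show "(\<Sum>v\<in>B. ext_scale emb (c v) v) \<in> ext_span emb B"
      by (intro E.span_sum E.span_scale E.span_base)
  qed
  moreover have "inj_on (\<lambda>c. \<Sum>v\<in>B. ext_scale emb (c v) v) (B \<rightarrow>\<^sub>E UNIV)"
  proof (rule inj_onI)
    fix c d assume cd: "c \<in> B \<rightarrow>\<^sub>E (UNIV :: 'f set)" "d \<in> B \<rightarrow>\<^sub>E (UNIV :: 'f set)"
      and eq: "(\<Sum>v\<in>B. ext_scale emb (c v) v) = (\<Sum>v\<in>B. ext_scale emb (d v) v)"
    have "(\<Sum>v\<in>B. ext_scale emb (c v - d v) v) = 0"
      using eq by (simp add: E.scale_left_diff_distrib sum_subtractf)
    then have "c v - d v = 0" if "v \<in> B" for v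
      using E.independentD[OF assms fin subset_refl, of "\<lambda>v. c v - d v"] that by blast
    then show "c = d" using cd by (intro PiE_ext) auto
  qed
  ultimately have "card (ext_span emb B) = card (B \<rightarrow>\<^sub>E (UNIV :: 'f set))"
    by (simp add: card_image)
  then show ?thesis by (simp add: card_PiE)
qed

lemma card_span: "card (ext_span emb S) = CARD('f) ^ ext_dim emb S"
proof -
  obtain B where B: "B \<subseteq> S" "E.independent B" "S \<subseteq> ext_span emb B" "card B = ext_dim emb S"
    using E.basis_exists[of S] by blast
  have "ext_span emb B = ext_span emb S"
    using B E.span_mono E.span_minimal E.subspace_span by (metis subset_antisym)
  then show ?thesis using card_span_independent[OF B(2)] B(4) by simp
qed

lemma card_subspace: "E.subspace W \<Longrightarrow> card W = CARD('f) ^ ext_dim emb W"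
  by (metis E.span_eq_iff card_span)

lemma dim_eq_iff_card: "E.subspace W \<Longrightarrow> ext_dim emb W = d \<longleftrightarrow> card W = CARD('f) ^ d"
  using card_subspace[of W] q_ge_2 power_inject_exp[of "CARD('f)"] by simp

lemma dim_mono: "V \<subseteq> ext_span emb W \<Longrightarrow> ext_dim emb V \<le> ext_dim emb W"
proof -
  assume "V \<subseteq> ext_span emb W"
  then have "ext_span emb V \<subseteq> ext_span emb W" by (simp add: E.span_minimal)
  then have "card (ext_span emb V) \<le> card (ext_span emb W)" by (intro card_mono) auto
  then show ?thesis using q_ge_2 by (simp add: card_span)
qed

lemma span_eqI_dim:
  assumes "V \<subseteq> ext_span emb W" "ext_dim emb V = ext_dim emb W"
  shows "ext_span emb V = ext_span emb W"
proof (rule card_subset_eq)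
  show "ext_span emb V \<subseteq> ext_span emb W" using assms(1) by (simp add: E.span_minimal)
qed (use assms in \<open>auto simp: card_span\<close>)

section \<open>The Frobenius map and the trace\<close>

lemma frobenius_add: "(x + y :: 'e) ^ CARD('f) = x ^ CARD('f) + y ^ CARD('f)"
proof -
  have *: "of_nat (CARD('f) choose i) = (0 :: 'e)" if "i \<in> {1..<CARD('f)}" for i
  proof -
    \<comment> \<open>\<open>emb\<close> sends \<open>of_nat\<close> to \<open>of_nat\<close>, so
      the vanishing in \<open>'f\<close> carries over to \<open>'e\<close>.\<close>
    have "emb (of_nat (CARD('f) choose i)) = emb 0"
      using finite_field_binomial_eq_0[where 'a='f, of i] that by simp
    then show ?thesis unfolding hom_of_nat hom_zero .
  qed
  have "{..CARD('f)} = insert 0 (insert CARD('f) {1..<CARD('f)})" by auto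
  then have "(\<Sum>i\<le>CARD('f). of_nat (CARD('f) choose i) * x ^ i * y ^ (CARD('f) - i)) =
      y ^ CARD('f) + (x ^ CARD('f) + (\<Sum>i\<in>{1..<CARD('f)}. of_nat (CARD('f) choose i) * x ^ i * y ^ (CARD('f) - i)))"
    using q_ge_2 by simp
  also have "(\<Sum>i\<in>{1..<CARD('f)}. of_nat (CARD('f) choose i) * x ^ i * y ^ (CARD('f) - i)) = 0"
    using * by (intro sum.neutral) simp
  finally show ?thesis by (simp add: binomial_ring)
qed

lemma frobenius_power_add: "(x + y :: 'e) ^ (CARD('f) ^ i) = x ^ (CARD('f) ^ i) + y ^ (CARD('f) ^ i)"
  by (induction i) (simp_all add: power_mult mult.commute[of "CARD('f)"] frobenius_add)

lemma frobenius_sum: "(\<Sum>i\<in>A. f i :: 'e) ^ CARD('f) = (\<Sum>i\<in>A. f i ^ CARD('f))"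
  using q_ge_2 by (induction A rule: infinite_finite_induct) (simp_all add: frobenius_add)

lemma emb_power_q: "emb c ^ CARD('f) = emb c"
  by (metis finite_field_power_card hom_power)

lemma emb_power_q_power: "emb c ^ (CARD('f) ^ i) = emb c"
  by (induction i) (simp_all add: power_mult emb_power_q)

text \<open>The ground field already supplies \<open>q\<close> roots of \<open>x ^ q - x\<close>,
  which is the most that its degree allows. Membership in the ground field is later always shown by
  this criterion.\<close>

lemma power_q_fixed_iff: "(x :: 'e) ^ CARD('f) = x \<longleftrightarrow> x \<in> range emb"
proof -
  have "range emb = {x :: 'e. x ^ CARD('f) = x}"
  proof (rule card_seteq)
    let ?p = "monom 1 CARD('f) - monom 1 1 :: 'e poly"
    have "coeff ?p CARD('f) = 1" using q_ge_2 by simp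
    then have "?p \<noteq> 0" by (metis coeff_0 zero_neq_one)
    then have "card {x :: 'e. poly ?p x = 0} \<le> degree ?p" by (rule card_poly_roots_bound)
    also have "\<dots> \<le> CARD('f)" using q_ge_2 by (intro degree_diff_le degree_monom_le[THEN order_trans]) auto
    finally show "card {x :: 'e. x ^ CARD('f) = x} \<le> card (range emb)"
      by (simp add: poly_monom card_image[OF inj_f])
  qed (auto simp: emb_power_q)
  then show ?thesis by auto
qed

lemma trace_add: "field_trace CARD('f) m (x + y :: 'e) = field_trace CARD('f) m x + field_trace CARD('f) m y"
  by (simp add: field_trace_def frobenius_power_add sum.distrib)

lemma trace_scale: "field_trace CARD('f) m (emb c * x :: 'e) = emb c * field_trace CARD('f) m x"
  by (simp add: field_trace_def power_mult_distrib emb_power_q_power sum_distrib_left)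

text \<open>The trace is defined with values in \<open>'e\<close>. Raising it to the power
  \<open>q\<close> shifts its summands cyclically, the last one wrapping around because
  \<open>x ^ (q ^ m) = x\<close>; so it is fixed by the Frobenius map.\<close>

lemma trace_in_range: "field_trace CARD('f) m (x :: 'e) \<in> range emb"
proof -
  have "field_trace CARD('f) m x ^ CARD('f) = (\<Sum>i<m. x ^ (CARD('f) ^ Suc i))"
    unfolding field_trace_def frobenius_sum
    by (simp add: power_mult[symmetric] mult.commute)
  also have "\<dots> = (\<Sum>i\<in>{1..<Suc m}. x ^ (CARD('f) ^ i))"
    by (simp only: lessThan_atLeast0 One_nat_def sum.shift_bounds_Suc_ivl)
  also have "{1..<Suc m} = insert m {1..<m}" using m_pos by auto
  also have "(\<Sum>i\<in>insert m {1..<m}. x ^ (CARD('f) ^ i)) = x + (\<Sum>i\<in>{1..<m}. x ^ (CARD('f) ^ i))"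
    using finite_field_power_card[of x] by (simp add: card_ext)
  also have "\<dots> = (\<Sum>i\<in>insert 0 {1..<m}. x ^ (CARD('f) ^ i))" by simp
  also have "insert 0 {1..<m} = {..<m}" using m_pos by auto
  finally show ?thesis by (simp add: field_trace_def flip: power_q_fixed_iff)
qed

text \<open>Otherwise the trace polynomial, whose degree is at most \<open>q ^ (m - 1)\<close>,
  would vanish at all \<open>q ^ m\<close> elements of the extension field.\<close>

lemma trace_nonzero: "\<exists>x :: 'e. field_trace CARD('f) m x \<noteq> 0"
proof (rule ccontr)
  assume "\<not> ?thesis"
  then have zero: "field_trace CARD('f) m x = 0" for x :: 'e by auto
  define p where "p = (\<Sum>i<m. monom (1 :: 'e) (CARD('f) ^ i))"
  have q1: "1 < CARD('f)" using q_ge_2 by simp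
  \<comment> \<open>The exponents \<open>q ^ i\<close> are distinct, so only the summand
    \<open>i = m - 1\<close> contributes.\<close>
  have "coeff p (CARD('f) ^ (m - 1)) = (\<Sum>i<m. if i = m - 1 then 1 else 0)"
    unfolding p_def coeff_sum using power_inject_exp[OF q1]
    by (intro sum.cong) (auto simp: coeff_monom)
  also have "\<dots> = 1" using m_pos by simp
  finally have "p \<noteq> 0" by auto
  then have "card {x. poly p x = 0} \<le> degree p" by (rule card_poly_roots_bound)
  also have "degree p \<le> CARD('f) ^ (m - 1)"
    unfolding p_def using q1
    by (intro degree_sum_le degree_monom_le[THEN order_trans] power_increasing) auto
  also have "\<dots> < CARD('f) ^ m" using q1 m_pos by (intro power_strict_increasing) auto
  finally show False
    using zero by (simp add: p_def poly_sum poly_monom field_trace_def card_ext)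
qed

text \<open>A functional that is not zero on \<open>W\<close> has a kernel of index
  \<open>q\<close>: after scaling some \<open>w0\<close> to have value 1, \<open>W\<close> is the
  direct sum of the line through \<open>w0\<close> and the kernel.\<close>

lemma card_kernel:
  fixes \<phi> :: "'e \<Rightarrow> 'e"
  assumes W: "E.subspace W"
    and add: "\<And>x y. \<phi> (x + y) = \<phi> x + \<phi> y"
    and scale: "\<And>c x. \<phi> (emb c * x) = emb c * \<phi> x"
    and range: "\<And>x. \<phi> x \<in> range emb"
    and nonzero: "\<exists>w\<in>W. \<phi> w \<noteq> 0"
  shows "CARD('f) * card {w \<in> W. \<phi> w = 0} = card W"
proof -
  obtain w c where w: "w \<in> W" "\<phi> w \<noteq> 0" "\<phi> w = emb c" using nonzero range by blast
  define w0 where "w0 = emb (inverse c) * w"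
  have W_scale: "emb a * x \<in> W" if "x \<in> W" for a x
    using E.subspace_scale[OF W that, of a] by (simp add: ext_scale_def)
  have w0: "w0 \<in> W" "\<phi> w0 = 1"
    using w W_scale by (simp_all add: w0_def scale flip: hom_mult)
  have "bij_betw (\<lambda>(a, v). emb a * w0 + v) (UNIV \<times> {w \<in> W. \<phi> w = 0}) W"
    unfolding bij_betw_def
  proof safe
    show "inj_on (\<lambda>(a, v). emb a * w0 + v) (UNIV \<times> {w \<in> W. \<phi> w = 0})"
    proof (rule inj_onI, clarify)
      fix a v a' v' assume "\<phi> v = 0" "\<phi> v' = 0" and eq: "emb a * w0 + v = emb a' * w0 + v'"
      have "\<phi> (emb a * w0 + v) = emb a" "\<phi> (emb a' * w0 + v') = emb a'"
        using \<open>\<phi> v = 0\<close> \<open>\<phi> v' = 0\<close> by (simp_all add: add scale w0)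
      then show "a = a' \<and> v = v'" using eq by simp
    qed
  next
    fix a v assume "v \<in> W"
    then show "emb a * w0 + v \<in> W" using W w0 W_scale E.subspace_add by blast
  next
    fix x assume x: "x \<in> W"
    obtain a where a: "\<phi> x = emb a" using range by blast
    have "\<phi> (x - emb a * w0) + \<phi> (emb a * w0) = \<phi> x" by (simp flip: add)
    then have "\<phi> (x - emb a * w0) = 0" by (simp add: scale a w0)
    moreover have "x - emb a * w0 \<in> W" using W w0 W_scale x E.subspace_diff by blast
    ultimately show "x \<in> (\<lambda>(a, v). emb a * w0 + v) ` (UNIV \<times> {w \<in> W. \<phi> w = 0})"
      by (intro image_eqI[where x = "(a, x - emb a * w0)"]) auto
  qed
  then show ?thesis by (simp add: bij_betw_same_card[symmetric] card_cartesian_product)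
qed

text \<open>Double counting of the pairs \<open>(w, b) \<in> W \<times> 'e\<close> with \<open>Tr (w b) = 0\<close>.\<close>

lemma card_trace_perp:
  assumes W: "E.subspace W"
  shows "card W * card (trace_perp CARD('f) m W) = CARD('e)"
proof -
  let ?T = "field_trace CARD('f) m :: 'e \<Rightarrow> 'e" and ?P = "trace_perp CARD('f) m W"
  let ?q = "CARD('f)" and ?Q = "CARD('e)"
  \<comment> \<open>For \<open>w = 0\<close> every \<open>b\<close> counts, and
    \<open>q Q = Q + (q - 1) Q\<close>; for other \<open>w\<close> the kernel has index
    \<open>q\<close>. Multiplying by \<open>q\<close> puts both cases into one formula without
    division.\<close>
  have row: "?q * card {b. ?T (w * b) = 0} = ?Q + (if w = 0 then (?q - 1) * ?Q else 0)" for w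
  proof (cases "w = 0")
    case True
    then show ?thesis using trace_scale[of 0] q_ge_2 by (simp add: algebra_simps)
  next
    case False
    obtain x where "?T x \<noteq> 0" using trace_nonzero by blast
    then have "?T (w * (x / w)) \<noteq> 0" using False by simp
    then have "\<exists>b\<in>UNIV. ?T (w * b) \<noteq> 0" by blast
    from card_kernel[OF E.subspace_UNIV, of "\<lambda>b. ?T (w * b)", OF _ _ _ this] show ?thesis
      using False trace_scale[of _ "w * _"]
      by (simp add: trace_add trace_in_range algebra_simps)
  qed
  have col: "?q * card {w \<in> W. ?T (w * b) = 0} = card W + (if b \<in> ?P then (?q - 1) * card W else 0)" for b
  proof (cases "b \<in> ?P")
    case True
    then have "{w \<in> W. ?T (w * b) = 0} = W" by (auto simp: trace_perp_def)
    then show ?thesis using True q_ge_2 by (simp add: algebra_simps)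
  next
    case False
    then have "\<exists>w\<in>W. ?T (w * b) \<noteq> 0" by (auto simp: trace_perp_def)
    from card_kernel[OF W, of "\<lambda>w. ?T (w * b)", OF _ _ _ this] show ?thesis
      using False by (simp add: trace_add trace_scale trace_in_range distrib_right mult.assoc)
  qed
  have "(\<Sum>w\<in>W. ?q * card {b. ?T (w * b) = 0}) = (\<Sum>b\<in>UNIV. ?q * card {w \<in> W. ?T (w * b) = 0})"
  proof -
    have "(\<Sum>w\<in>W. card {b. ?T (w * b) = 0}) = (\<Sum>w\<in>W. \<Sum>b\<in>UNIV. of_bool (?T (w * b) = 0))"
      by (simp add: of_bool_def sum.If_cases)
    also have "\<dots> = (\<Sum>b\<in>UNIV. \<Sum>w\<in>W. of_bool (?T (w * b) = 0))" by (rule sum.swap)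
    also have "\<dots> = (\<Sum>b\<in>UNIV. card {w \<in> W. ?T (w * b) = 0})"
      by (simp add: of_bool_def sum.If_cases Int_def)
    finally show ?thesis by (simp flip: sum_distrib_left)
  qed
  \<comment> \<open>Only \<open>w = 0\<close> contributes the extra term on the left, while each
    element of the orthogonal space does so on the right. Cancelling leaves the claim.\<close>
  then have "card W * ?Q + (?q - 1) * ?Q = ?Q * card W + (?q - 1) * card W * card ?P"
    unfolding row col using E.subspace_0[OF W]
    by (simp add: sum.distrib sum.If_cases mult.commute)
  then show ?thesis using q_ge_2 by simp
qed

lemma subspace_trace_perp: "E.subspace (trace_perp CARD('f) m W)"
proof (rule E.subspaceI)
  have "field_trace CARD('f) m (0 :: 'e) = 0" using trace_scale[of 0] by simp
  then show "0 \<in> trace_perp CARD('f) m W" by (simp add: trace_perp_def)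
next
  fix x c assume "x \<in> trace_perp CARD('f) m W"
  then show "ext_scale emb c x \<in> trace_perp CARD('f) m W"
    using trace_scale[of c "_ * x"] by (simp add: trace_perp_def ext_scale_def mult.left_commute)
qed (simp add: trace_perp_def trace_add distrib_left)

text \<open>One inclusion is clear, and applying \<open>card_trace_perp\<close> to \<open>W\<close>
  and to its orthogonal space shows that the two sides have equally many elements.\<close>

lemma trace_perp_trace_perp:
  assumes W: "E.subspace W"
  shows "trace_perp CARD('f) m (trace_perp CARD('f) m W) = W"
proof -
  let ?P = "trace_perp CARD('f) m W"
  have "card ?P * card W = card ?P * card (trace_perp CARD('f) m ?P)"
    using card_trace_perp[OF W] card_trace_perp[OF subspace_trace_perp, of W] by (simp add: mult.commute)
  moreover have "card ?P > 0" using E.subspace_0[OF subspace_trace_perp, of W] by (auto simp: card_gt_0_iff)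
  ultimately have "card W = card (trace_perp CARD('f) m ?P)" by (simp only: nat_mult_eq_cancel1)
  moreover have "W \<subseteq> trace_perp CARD('f) m ?P" by (auto simp: trace_perp_def mult.commute)
  ultimately show ?thesis by (intro card_subset_eq[symmetric]) auto
qed

text \<open>This is where the primality of \<open>m\<close> acts. The multipliers of
  \<open>U\<close> form a multiplicatively closed subspace with \<open>q ^ d\<close> elements,
  \<open>0 < d < m\<close>. Each multiplier is thus fixed by the \<open>d\<close>-th and by the
  \<open>m\<close>-th iterate of the Frobenius map, hence, as \<open>d\<close> and \<open>m\<close>
  are coprime, by the map itself.\<close>

lemma stabilizer_eq_range:
  assumes m: "prime m" and U: "E.subspace U" and dim: "0 < ext_dim emb U" "ext_dim emb U < m"
  shows "{c. \<forall>u\<in>U. c * u \<in> U} = range emb"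
proof
  show "range emb \<subseteq> {c. \<forall>u\<in>U. c * u \<in> U}"
    using E.subspace_scale[OF U] by (auto simp: ext_scale_def)
next
  let ?S = "{c. \<forall>u\<in>U. c * u \<in> U}"
  have S: "E.subspace ?S"
  proof (rule E.subspaceI)
    fix a x assume "x \<in> ?S"
    then show "ext_scale emb a x \<in> ?S"
      using E.subspace_scale[OF U, of _ a] by (simp add: ext_scale_def mult.assoc)
  qed (use U in \<open>auto simp: E.subspace_0 E.subspace_add distrib_right\<close>)
  define d where "d = ext_dim emb ?S"
  have card_S: "card ?S = CARD('f) ^ d" unfolding d_def by (rule card_subspace[OF S])
  have q1: "1 < CARD('f)" using q_ge_2 by simp
  have card_U: "card U = CARD('f) ^ ext_dim emb U" by (rule card_subspace[OF U])
  have "U \<noteq> {0}"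
  proof
    assume "U = {0}"
    then have "CARD('f) ^ ext_dim emb U = 1" using card_U by simp
    then show False using dim(1) q1 by simp
  qed
  then obtain u where u: "u \<in> U" "u \<noteq> 0" using E.subspace_0[OF U] by blast
  \<comment> \<open>Evaluation at a nonzero \<open>u\<close> embeds the multipliers into
    \<open>U\<close>, so \<open>d\<close> is at most the dimension of \<open>U\<close>.\<close>
  have "d < m"
  proof -
    have "(\<lambda>c. c * u) ` ?S \<subseteq> U" using u by auto
    moreover have "inj_on (\<lambda>c. c * u) ?S" using u by (auto simp: inj_on_def)
    ultimately have "card ?S \<le> card U" using card_inj_on_le[of "\<lambda>c. c * u" ?S U] by simp
    then have "d \<le> ext_dim emb U" using card_U card_S q1 by simp
    then show ?thesis using dim by simp
  qed
  moreover have "0 < d"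
  proof (rule ccontr)
    assume "\<not> 0 < d"
    then have "card ?S = 1" using card_S by simp
    moreover have "card {0, 1 :: 'e} \<le> card ?S" using E.subspace_0[OF U] by (intro card_mono) auto
    ultimately show False by simp
  qed
  ultimately have "coprime d m"
    using m by (metis coprime_commute nat_dvd_not_less prime_imp_coprime_nat)
  then obtain a b where ab: "d * a = m * b + 1"
    using bezout_nat[of d m] \<open>0 < d\<close> by (auto simp: mult.commute)
  show "?S \<subseteq> range emb"
  proof
    fix c assume c: "c \<in> ?S"
    have 1: "c ^ (CARD('f) ^ d) = c"
      using power_card_mult_closed[of ?S c] c card_S E.subspace_0[OF U] by (simp add: mult.assoc)
    have 2: "x ^ (CARD('f) ^ m) = x" for x :: 'e
      using finite_field_power_card[of x] by (simp add: card_ext)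
    have 3: "c ^ (CARD('f) ^ (d * i)) = c" for i
      by (induction i) (simp_all add: power_add power_mult 1)
    have 4: "x ^ (CARD('f) ^ (m * i)) = x" for x :: 'e and i
      by (induction i) (simp_all add: power_add power_mult 2)
    \<comment> \<open>By \<open>d * a = m * b + 1\<close>, the \<open>d\<close>-th iterate applied
      \<open>a\<close> times equals the \<open>m\<close>-th iterate applied \<open>b\<close> times
      followed by one more Frobenius map.\<close>
    have "c = c ^ (CARD('f) ^ (m * b + 1))" using 3[of a] ab by simp
    also have "\<dots> = (c ^ (CARD('f) ^ (m * b))) ^ CARD('f)" by (simp add: power_mult[symmetric] mult.commute)
    also have "\<dots> = c ^ CARD('f)" by (simp add: 4)
    finally show "c \<in> range emb" by (simp flip: power_q_fixed_iff)
  qed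
qed

text \<open>The orthogonal space of \<open>U\<^sup>\<bottom> U\<close> is the stabilizer of \<open>U\<close>.\<close>

lemma dim_space_prod_trace_perp:
  assumes m: "prime m" and U: "E.subspace U" and dim: "0 < ext_dim emb U" "ext_dim emb U < m"
  shows "ext_dim emb (space_prod emb (trace_perp CARD('f) m U) U) = m - 1"
proof -
  let ?P = "trace_perp CARD('f) m U"
  let ?X = "{a * b | a b. a \<in> ?P \<and> b \<in> U}"
  \<comment> \<open>Orthogonality to the generators suffices: the elements orthogonal to a fixed
    \<open>b\<close> form a subspace, which contains the span of \<open>X\<close> once it contains
    \<open>X\<close>.\<close>
  have perp_span: "trace_perp CARD('f) m (ext_span emb X) = trace_perp CARD('f) m X" for X
  proof
    show "trace_perp CARD('f) m (ext_span emb X) \<subseteq> trace_perp CARD('f) m X"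
      using E.span_superset by (auto simp: trace_perp_def)
    show "trace_perp CARD('f) m X \<subseteq> trace_perp CARD('f) m (ext_span emb X)"
    proof
      fix b assume b: "b \<in> trace_perp CARD('f) m X"
      then have "X \<subseteq> trace_perp CARD('f) m {b}" by (auto simp: trace_perp_def mult.commute)
      then have "ext_span emb X \<subseteq> trace_perp CARD('f) m {b}"
        by (intro E.span_minimal subspace_trace_perp)
      then show "b \<in> trace_perp CARD('f) m (ext_span emb X)" by (auto simp: trace_perp_def mult.commute)
    qed
  qed
  have assoc: "a * u * c = a * (c * u)" for a u c :: 'e by (simp add: ac_simps)
  have "trace_perp CARD('f) m ?X = {c. \<forall>a\<in>?P. \<forall>u\<in>U. field_trace CARD('f) m (a * u * c) = 0}"
    unfolding trace_perp_def[of _ _ ?X] by blast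
  also have "\<dots> = {c. \<forall>u\<in>U. c * u \<in> trace_perp CARD('f) m ?P}"
    unfolding trace_perp_def[of _ _ ?P] assoc by blast
  also have "\<dots> = range emb"
    unfolding trace_perp_trace_perp[OF U] by (rule stabilizer_eq_range[OF m U dim])
  \<comment> \<open>The orthogonal space of the span has exactly \<open>q\<close> elements, so the
    span itself has \<open>q ^ m / q\<close> elements.\<close>
  finally have "card (ext_span emb ?X) * CARD('f) = CARD('f) ^ m"
    using card_trace_perp[OF E.subspace_span, of ?X]
    by (simp add: perp_span card_image[OF inj_f] card_ext)
  also have "\<dots> = CARD('f) ^ (m - 1) * CARD('f)" using m_pos by (simp flip: power_Suc2)
  finally have "card (ext_span emb ?X) = CARD('f) ^ (m - 1)" using q_ge_2 by simp
  then show ?thesis by (simp add: space_prod_def dim_eq_iff_card flip: dim_eq_iff_card[OF E.subspace_span])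
qed

end

subsection \<open>Block vectors and block-diagonal matrices\<close>

lemma row_mult_carrier [simp]:
  "A \<in> carrier_mat n n' \<Longrightarrow> row_mult x A \<in> carrier_vec n'"
  by (simp add: row_mult_def carrier_vecI)

lemma dim_row_mult [simp]: "dim_vec (row_mult x A) = dim_col A"
  by (simp add: row_mult_def)

lemma row_mult_index:
  "x \<in> carrier_vec n \<Longrightarrow> A \<in> carrier_mat n n' \<Longrightarrow> j < n' \<Longrightarrow>
    row_mult x A $ j = (\<Sum>i<n. A $$ (i, j) * x $ i)"
  by (auto simp: row_mult_def scalar_prod_def atLeast0LessThan intro!: sum.cong)

lemma row_mult_mult:
  assumes "x \<in> carrier_vec n" "A \<in> carrier_mat n n'" "B \<in> carrier_mat n' n''"
  shows "row_mult x (A * B) = row_mult (row_mult x A) B"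
proof -
  have "B\<^sup>T \<in> carrier_mat n'' n'" "A\<^sup>T \<in> carrier_mat n' n" using assms by auto
  then show ?thesis
    using assms by (simp add: row_mult_def transpose_mult[OF assms(2,3)])
qed

lemma row_mult_one: "x \<in> carrier_vec n \<Longrightarrow> row_mult x (1\<^sub>m n) = x"
  by (simp add: row_mult_def)

lemma row_mult_add:
  assumes "x \<in> carrier_vec n" "y \<in> carrier_vec n" "A \<in> carrier_mat n n'"
  shows "row_mult (x + y) A = row_mult x A + row_mult y A"
  unfolding row_mult_def using assms by (intro mult_add_distrib_mat_vec) auto

lemma row_mult_smult:
  assumes "x \<in> carrier_vec n" "A \<in> carrier_mat n n'"
  shows "row_mult (a \<cdot>\<^sub>v x) A = a \<cdot>\<^sub>v row_mult x A"
  unfolding row_mult_def using assms by (intro mult_mat_vec) auto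

lemma concat_vec_simps [simp]:
  "concat_vec [] = vNil" "concat_vec (v # vs) = v @\<^sub>v concat_vec vs"
  by (simp_all add: concat_vec_def)

lemma dim_concat_vec: "dim_vec (concat_vec vs) = sum_list (map dim_vec vs)"
  by (induction vs) auto

lemma vec_set_smult: "set\<^sub>v (a \<cdot>\<^sub>v v) = (*) a ` set\<^sub>v v"
  by (auto simp: vec_set_def image_image)

lemma vec_set_append [simp]: "set\<^sub>v (v @\<^sub>v w) = set\<^sub>v v \<union> set\<^sub>v w"
proof -
  let ?a = "dim_vec v" and ?b = "dim_vec w"
  have "{..<?a + ?b} = {..<?a} \<union> (+) ?a ` {0..<?b}"
    by (subst image_add_atLeastLessThan) auto
  then have "set\<^sub>v (v @\<^sub>v w) = (\<lambda>i. (v @\<^sub>v w) $ i) ` {..<?a} \<union> (\<lambda>i. (v @\<^sub>v w) $ (?a + i)) ` {0..<?b}"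
    by (simp only: vec_set_def index_append_vec(2) image_Un image_image)
  also have "(\<lambda>i. (v @\<^sub>v w) $ i) ` {..<?a} = set\<^sub>v v"
    unfolding vec_set_def by (intro image_cong) auto
  also have "(\<lambda>i. (v @\<^sub>v w) $ (?a + i)) ` {0..<?b} = set\<^sub>v w"
    unfolding vec_set_def by (intro image_cong) auto
  finally show ?thesis .
qed

lemma vec_set_concat: "set\<^sub>v (concat_vec vs) = (\<Union>v\<in>set vs. set\<^sub>v v)"
proof (induction vs)
  case Nil
  show ?case by (simp add: vec_set_def)
qed simp

lemma concat_vec_inject:
  assumes "\<And>i. i \<in> set is \<Longrightarrow> dim_vec (x i) = dim_vec (y i)"
    and "concat_vec (map x is) = concat_vec (map y is)" and "i \<in> set is"
  shows "x i = y i"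
  using assms
proof (induction "is")
  case (Cons j js)
  have "x j \<in> carrier_vec (dim_vec (x j))" "y j \<in> carrier_vec (dim_vec (x j))"
    using Cons.prems(1) by (auto intro: carrier_vecI)
  from append_vec_eq[OF this] Cons show ?case by auto
qed simp

text \<open>Serves twice: with single rows as blocks it describes the words of a block-diagonal
  generator matrix, with square blocks it describes a change of basis in each block.\<close>

lemma row_mult_diag_block_mat:
  fixes x :: "'i \<Rightarrow> 'a :: field vec"
  assumes "\<And>i. i \<in> set is \<Longrightarrow> dim_vec (x i) = dim_row (B i)"
  shows "row_mult (concat_vec (map x is)) (diag_block_mat (map B is)) =
    concat_vec (map (\<lambda>i. row_mult (x i) (B i)) is)"
  using assms
proof (induction "is")
  case Nil
  show ?case by (rule eq_vecI) auto
next
  case (Cons i "is")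
  let ?D = "diag_block_mat (map B is)" and ?y = "concat_vec (map x is)"
  have zero: "0\<^sub>m nr nc *\<^sub>v v = 0\<^sub>v nr" if "v \<in> carrier_vec nc" for nr nc and v :: "'a vec"
    using that by (intro eq_vecI) auto
  have "dim_vec ?y = dim_row ?D"
    using Cons.prems by (simp add: dim_concat_vec dim_diag_block_mat comp_def cong: map_cong)
  then have y: "?y \<in> carrier_vec (dim_row ?D)" by (intro carrier_vecI)
  have x: "x i \<in> carrier_vec (dim_row (B i))" using Cons.prems by (intro carrier_vecI) auto
  have "(diag_block_mat (map B (i # is)))\<^sup>T = four_block_mat (B i)\<^sup>T
      (0\<^sub>m (dim_col (B i)) (dim_row ?D)) (0\<^sub>m (dim_col ?D) (dim_row (B i))) ?D\<^sup>T"
    by (subst list.map, subst diag_block_mat.simps, unfold Let_def, subst transpose_four_block_mat) auto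
  then have "row_mult (concat_vec (map x (i # is))) (diag_block_mat (map B (i # is))) =
      ((B i)\<^sup>T *\<^sub>v x i + 0\<^sub>m (dim_col (B i)) (dim_row ?D) *\<^sub>v ?y) @\<^sub>v
      (0\<^sub>m (dim_col ?D) (dim_row (B i)) *\<^sub>v x i + ?D\<^sup>T *\<^sub>v ?y)"
    unfolding row_mult_def using x y
    by (simp, intro four_block_mat_mult_vec) auto
  also have "\<dots> = row_mult (x i) (B i) @\<^sub>v row_mult ?y ?D"
    unfolding row_mult_def zero[OF x] zero[OF y]
    by (intro arg_cong2[of _ _ _ _ append_vec] left_zero_vec right_zero_vec) (rule carrier_vecI, simp)+
  also have "row_mult ?y ?D = concat_vec (map (\<lambda>i. row_mult (x i) (B i)) is)"
    using Cons by auto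
  finally show ?case by simp
qed

lemma four_block_mat_diag_mult:
  fixes A B :: "'a :: comm_ring_1 mat"
  assumes "A \<in> carrier_mat n n'" "D \<in> carrier_mat p p'" "B \<in> carrier_mat n' n''" "E \<in> carrier_mat p' p''"
  shows "four_block_mat A (0\<^sub>m n p') (0\<^sub>m p n') D * four_block_mat B (0\<^sub>m n' p'') (0\<^sub>m p' n'') E =
    four_block_mat (A * B) (0\<^sub>m n p'') (0\<^sub>m p n'') (D * E)"
proof -
  have "A * B \<in> carrier_mat n n''" "D * E \<in> carrier_mat p p''" using assms by auto
  then show ?thesis
    using assms by (subst mult_four_block_mat[OF assms(1) zero_carrier_mat zero_carrier_mat assms(2)
          assms(3) zero_carrier_mat zero_carrier_mat assms(4)]) simp
qed

lemma diag_block_mat_mult: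
  assumes "\<And>i. i \<in> set is \<Longrightarrow> dim_col (A i) = dim_row (B i)"
  shows "diag_block_mat (map A is) * diag_block_mat (map B is) =
    diag_block_mat (map (\<lambda>i. A i * B i :: 'a :: comm_ring_1 mat) is)"
  using assms
proof (induction "is")
  case Nil
  show ?case by (rule eq_matI) auto
next
  case (Cons i "is")
  let ?A = "diag_block_mat (map A is)" and ?B = "diag_block_mat (map B is)"
  have dims: "dim_col (A i) = dim_row (B i)" "dim_col ?A = dim_row ?B"
    using Cons.prems by (auto simp: dim_diag_block_mat comp_def cong: map_cong)
  have "diag_block_mat (map A (i # is)) * diag_block_mat (map B (i # is)) =
     four_block_mat (A i * B i) (0\<^sub>m (dim_row (A i)) (dim_col ?B)) (0\<^sub>m (dim_row ?A) (dim_col (B i))) (?A * ?B)"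
    unfolding list.map diag_block_mat.simps Let_def dims
    by (rule four_block_mat_diag_mult) (use dims in auto)
  also have "?A * ?B = diag_block_mat (map (\<lambda>i. A i * B i) is)"
    using Cons by auto
  finally show ?case
    by (simp add: Let_def dim_diag_block_mat comp_def)
qed

lemma diag_block_mat_one: "diag_block_mat (map (\<lambda>i. 1\<^sub>m (d i)) is) = 1\<^sub>m (sum_list (map d is))"
  by (induction "is") (auto simp: Let_def)

lemma map_diag_block_mat:
  assumes "h 0 = 0"
  shows "map_mat h (diag_block_mat (map A is)) = diag_block_mat (map (\<lambda>i. map_mat h (A i)) is)"
proof (induction "is")
  case (Cons i "is")
  let ?D = "diag_block_mat (map A is)"
  have "map_mat h (0\<^sub>m nr nc) = 0\<^sub>m nr nc" for nr nc using assms by (intro eq_matI) auto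
  then have "map_mat h (four_block_mat (A i) (0\<^sub>m (dim_row (A i)) (dim_col ?D)) (0\<^sub>m (dim_row ?D) (dim_col (A i))) ?D)
      = four_block_mat (map_mat h (A i)) (0\<^sub>m (dim_row (A i)) (dim_col ?D)) (0\<^sub>m (dim_row ?D) (dim_col (A i))) (map_mat h ?D)"
    by (subst map_four_block_mat[of _ "dim_row (A i)" "dim_col (A i)" _ "dim_col ?D" _ "dim_row ?D"]) auto
  then show ?case by (simp add: Let_def flip: Cons.IH)
qed auto

text \<open>The definition of \<open>invertible_mat\<close> leaves the format of the inverse open;
  it is recovered by comparing the formats of both sides of the two products.\<close>

lemma invertible_matE:
  assumes "invertible_mat A" "A \<in> carrier_mat n n"
  obtains B where "B \<in> carrier_mat n n" "A * B = 1\<^sub>m n" "B * A = 1\<^sub>m n"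
proof -
  obtain B where B: "A * B = 1\<^sub>m n" "B * A = 1\<^sub>m (dim_row B)"
    using assms by (auto simp: invertible_mat_def inverts_mat_def)
  have "dim_col (A * B) = n" "dim_col (B * A) = dim_row B" using B by simp_all
  then have "B \<in> carrier_mat n n" using assms(2) by auto
  then show ?thesis using that B by auto
qed

lemma invertible_matI:
  "A \<in> carrier_mat n n \<Longrightarrow> B \<in> carrier_mat n n \<Longrightarrow> A * B = 1\<^sub>m n \<Longrightarrow> B * A = 1\<^sub>m n \<Longrightarrow> invertible_mat A"
  by (auto simp: invertible_mat_def inverts_mat_def)

lemma invertible_diag_block_mat:
  fixes A :: "'i \<Rightarrow> 'a :: comm_ring_1 mat"
  assumes A: "\<And>i. i \<in> set is \<Longrightarrow> A i \<in> carrier_mat (d i) (d i)"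
    and inv: "\<And>i. i \<in> set is \<Longrightarrow> invertible_mat (A i)"
  shows "invertible_mat (diag_block_mat (map A is))"
proof -
  have "\<exists>B. B \<in> carrier_mat (d i) (d i) \<and> A i * B = 1\<^sub>m (d i) \<and> B * A i = 1\<^sub>m (d i)"
    if "i \<in> set is" for i
    using A inv that by (metis invertible_matE)
  then obtain B where B: "\<And>i. i \<in> set is \<Longrightarrow> B i \<in> carrier_mat (d i) (d i)"
    "\<And>i. i \<in> set is \<Longrightarrow> A i * B i = 1\<^sub>m (d i)" "\<And>i. i \<in> set is \<Longrightarrow> B i * A i = 1\<^sub>m (d i)"
    by metis
  let ?n = "sum_list (map d is)"
  show ?thesis
  proof (rule invertible_matI[where n = ?n and B = "diag_block_mat (map B is)"])
    have "map dim_row (map X is) = map d is" "map dim_col (map X is) = map d is"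
      if "\<And>i. i \<in> set is \<Longrightarrow> X i \<in> carrier_mat (d i) (d i)" for X :: "'i \<Rightarrow> 'a mat"
      using that by auto
    from this[of A] this[of B] A B(1)
    show "diag_block_mat (map A is) \<in> carrier_mat ?n ?n" "diag_block_mat (map B is) \<in> carrier_mat ?n ?n"
      by (metis carrier_matI dim_diag_block_mat)+
    have "map (\<lambda>i. A i * B i) is = map (\<lambda>i. 1\<^sub>m (d i)) is" "map (\<lambda>i. B i * A i) is = map (\<lambda>i. 1\<^sub>m (d i)) is"
      using B by auto
    moreover have "dim_col (A i) = dim_row (B i)" "dim_col (B i) = dim_row (A i)" if "i \<in> set is" for i
      using A[OF that] B(1)[OF that] by auto
    ultimately show "diag_block_mat (map A is) * diag_block_mat (map B is) = 1\<^sub>m ?n"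
      "diag_block_mat (map B is) * diag_block_mat (map A is) = 1\<^sub>m ?n"
      using diag_block_mat_mult[of "is" A B] diag_block_mat_mult[of "is" B A] diag_block_mat_one[of d "is"]
      by metis+
  qed
qed

lemma (in comm_ring_hom) invertible_map_mat:
  assumes "invertible_mat A" "A \<in> carrier_mat n n"
  shows "invertible_mat (map_mat hom A)"
proof -
  obtain B where B: "B \<in> carrier_mat n n" "A * B = 1\<^sub>m n" "B * A = 1\<^sub>m n"
    using invertible_matE[OF assms] .
  show ?thesis
    using assms(2) B by (intro invertible_matI[where B = "map_mat hom B" and n = n])
      (simp_all add: mat_hom_one flip: mat_hom_mult)
qed

lemma invertible_mat_mult:
  fixes A B :: "'a :: comm_ring_1 mat"
  assumes "invertible_mat A" "A \<in> carrier_mat n n" "invertible_mat B" "B \<in> carrier_mat n n"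
  shows "invertible_mat (A * B)"
proof -
  obtain A' where A': "A' \<in> carrier_mat n n" "A * A' = 1\<^sub>m n" "A' * A = 1\<^sub>m n"
    using invertible_matE[OF assms(1,2)] .
  obtain B' where B': "B' \<in> carrier_mat n n" "B * B' = 1\<^sub>m n" "B' * B = 1\<^sub>m n"
    using invertible_matE[OF assms(3,4)] .
  have "A * B * (B' * A') = A * (B * B') * A'" "B' * A' * (A * B) = B' * (A' * A) * B"
    using assms(2,4) A'(1) B'(1) by (simp_all only: assoc_mult_mat[of _ n n _ n _ n] mult_carrier_mat[of _ n n _ n])
  then have "A * B * (B' * A') = 1\<^sub>m n" "B' * A' * (A * B) = 1\<^sub>m n"
    using assms A' B' by simp_all
  then show ?thesis
    using assms A' B' by (intro invertible_matI[where B = "B' * A'" and n = n]) auto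
qed

lemma inj_on_row_mult:
  fixes A :: "'a :: field mat"
  assumes "invertible_mat A" "A \<in> carrier_mat n n"
  shows "inj_on (\<lambda>c. row_mult c A) (carrier_vec n)"
proof -
  obtain B where B: "B \<in> carrier_mat n n" "A * B = 1\<^sub>m n" using invertible_matE[OF assms] .
  have "row_mult (row_mult c A) B = c" if "c \<in> carrier_vec n" for c
    using row_mult_mult[OF that assms(2) B(1)] that B(2) by (simp add: row_mult_one)
  then show ?thesis by (rule inj_on_inverseI)
qed

section \<open>Codes, generator matrices and equivalence\<close>

lemma finite_carrier_vec: "finite (carrier_vec n :: 'a :: finite vec set)"
proof (rule finite_subset)
  show "carrier_vec n \<subseteq> vec n ` ({..<n} \<rightarrow>\<^sub>E (UNIV :: 'a set))"
  proof
    fix x :: "'a vec" assume "x \<in> carrier_vec n"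
    then have "x = vec n (restrict (($) x) {..<n})" by (intro eq_vecI) auto
    then show "x \<in> vec n ` ({..<n} \<rightarrow>\<^sub>E UNIV)" by (intro image_eqI[where f = "vec n" and x = "restrict (($) x) {..<n}"]) auto
  qed
qed (intro finite_imageI finite_PiE, auto)

lemma is_code_carrier: "is_code n k C \<Longrightarrow> C \<subseteq> carrier_vec n"
  by (auto simp: is_code_def VectorSpace.subspace_def submodule_def module_vec_simps)

text \<open>Right multiplication by an invertible matrix, restricted to \<open>C\<close>, is a
  linear map with trivial kernel, so the rank-nullity theorem preserves the dimension.\<close>

lemma is_code_image:
  fixes C :: "'e :: {field, finite} vec set"
  assumes C: "is_code n k C" and A: "invertible_mat A" "A \<in> carrier_mat n n"
  shows "is_code n k ((\<lambda>c. row_mult c A) ` C)"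
proof -
  let ?V = "module_vec TYPE('e) n" and ?T = "\<lambda>c. row_mult c A"
  interpret V: vectorspace class_ring ?V by (rule vec_vs)
  have sub: "VectorSpace.subspace class_ring C ?V" using C by (simp add: is_code_def)
  interpret C: vectorspace class_ring "?V\<lparr>carrier := C\<rparr>" by (rule V.subspace_is_vs[OF sub])
  have CV: "C \<subseteq> carrier_vec n" using C by (rule is_code_carrier)
  interpret T: linear_map class_ring "?V\<lparr>carrier := C\<rparr>" ?V ?T
  proof unfold_locales
    show "?T \<in> LinearCombinations.module_hom class_ring (?V\<lparr>carrier := C\<rparr>) ?V"
      unfolding LinearCombinations.module_hom_def module_vec_def
      using CV A by (auto simp: subset_iff intro!: row_mult_carrier row_mult_add[of _ n _ A n] row_mult_smult[of _ n A n])
  qed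
  have im: "T.im = ?T ` C" by (simp add: T.im_def)
  have fin: "finite C" using CV finite_carrier_vec finite_subset by blast
  \<comment> \<open>Being finite, \<open>C\<close> can serve as its own finite generating
    set.\<close>
  have "C.fin_dim" unfolding C.fin_dim_def
    using fin C.in_own_span[of C] C.span_is_subset2[of C] by (intro exI[of _ C]) auto
  from T.rank_nullity[OF this] T.inj_imp_dim_ker0
  have "vectorspace.dim class_ring (?V\<lparr>carrier := T.im\<rparr>) = vectorspace.dim class_ring (?V\<lparr>carrier := C\<rparr>)"
    using inj_on_subset[OF inj_on_row_mult[OF A] CV] by simp
  then show ?thesis
    using T.imT_is_subspace C unfolding im is_code_def by simp
qed

text \<open>Reads a coefficient vector as a concatenation of blocks of length 1, the format that the
  blockwise product with \<open>block_matrix\<close> expects. The start \<open>s\<close> is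
  arbitrary because the induction removes the first index.\<close>

lemma concat_vec_singletons:
  "concat_vec (map (\<lambda>i. vec 1 (\<lambda>_. a i)) [s..<s + k]) = vec k (\<lambda>j. a (s + j))"
proof (induction k arbitrary: s)
  case 0
  show ?case by (intro eq_vecI) auto
next
  case (Suc k)
  have "[s..<s + Suc k] = s # [Suc s..<Suc s + k]" by (simp add: upt_conv_Cons del: upt_Suc)
  then have "concat_vec (map (\<lambda>i. vec 1 (\<lambda>_. a i)) [s..<s + Suc k]) =
      vec 1 (\<lambda>_. a s) @\<^sub>v vec k (\<lambda>j. a (Suc s + j))"
    using Suc.IH[of "Suc s"] by (simp del: upt_Suc)
  also have "\<dots> = vec (Suc k) (\<lambda>j. a (s + j))" by (intro eq_vecI) auto
  finally show ?case .
qed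

lemma row_mult_mat_of_row: "row_mult (vec 1 (\<lambda>_. a)) (mat_of_row u) = a \<cdot>\<^sub>v u"
  by (intro eq_vecI) (auto simp: row_mult_def scalar_prod_def)

lemma row_mult_block_matrix:
  "row_mult (vec k (\<lambda>j. a (1 + j))) (block_matrix k us) = concat_vec (map (\<lambda>i. a i \<cdot>\<^sub>v us i) [1..<k+1])"
proof -
  have "vec k (\<lambda>j. a (1 + j)) = concat_vec (map (\<lambda>i. vec 1 (\<lambda>_. a i)) [1..<k+1])"
    using concat_vec_singletons[of a 1 k] by (simp add: add.commute del: upt_Suc)
  then show ?thesis
    unfolding block_matrix_def
    by (simp only: row_mult_diag_block_mat[of "[1..<k+1]" "\<lambda>i. vec 1 (\<lambda>_. a i)" "\<lambda>i. mat_of_row (us i)"]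
        dim_vec mat_of_row_dim row_mult_mat_of_row)
qed

text \<open>Puncturing at 1 removes nothing, so words of the code can be handled as functions of
  their coefficients. Vector entries are numbered from 0 and blocks from 1, hence the shifts by
  one.\<close>

lemma block_code_eq_punctured:
  "{row_mult x (block_matrix k us) | x. x \<in> carrier_vec k} = punctured k us 1"
proof safe
  fix x :: "'a vec" assume "x \<in> carrier_vec k"
  then have "x = vec k (\<lambda>j. x $ (1 + j - 1))" by (intro eq_vecI) auto
  then show "row_mult x (block_matrix k us) \<in> punctured k us 1"
    using row_mult_block_matrix[of k "\<lambda>i. x $ (i - 1)" us] unfolding punctured_def
    by (intro CollectI exI[of _ "\<lambda>i. x $ (i - 1)"]) simp
next
  fix c assume "c \<in> punctured k us 1"
  then obtain a where "c = concat_vec (map (\<lambda>i. a i \<cdot>\<^sub>v us i) [1..<k+1])"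
    unfolding punctured_def by blast
  then have "c = row_mult (vec k (\<lambda>j. a (1 + j))) (block_matrix k us)"
    by (simp only: row_mult_block_matrix)
  then show "\<exists>x. c = row_mult x (block_matrix k us) \<and> x \<in> carrier_vec k"
    using vec_carrier by blast
qed

lemma block_matrix_carrier:
  assumes "\<And>i. i \<in> {1..k} \<Longrightarrow> us i \<in> carrier_vec (nn i)"
  shows "block_matrix k us \<in> carrier_mat k (\<Sum>i=1..k. nn i)"
proof (rule carrier_matI)
  have "map (\<lambda>i. dim_vec (us i)) [1..<k+1] = map nn [1..<k+1]" using assms by auto
  then show "dim_col (block_matrix k us) = (\<Sum>i=1..k. nn i)"
    by (simp add: block_matrix_def dim_diag_block_mat comp_def sum_list_distinct_conv_sum_set
        atLeastLessThanSuc_atLeastAtMost del: upt_Suc)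
qed (simp add: block_matrix_def dim_diag_block_mat comp_def sum_list_triv del: upt_Suc)

lemma code_equiv_trans:
  assumes "field_hom emb" and C: "C \<subseteq> carrier_vec n"
    and "code_equiv emb n C D" "code_equiv emb n D E"
  shows "code_equiv emb n C E"
proof -
  interpret field_hom emb by fact
  obtain A where A: "A \<in> carrier_mat n n" "invertible_mat A" "D = (\<lambda>c. row_mult c (map_mat emb A)) ` C"
    using assms(3) by (auto simp: code_equiv_def)
  obtain B where B: "B \<in> carrier_mat n n" "invertible_mat B" "E = (\<lambda>c. row_mult c (map_mat emb B)) ` D"
    using assms(4) by (auto simp: code_equiv_def)
  have "row_mult c (map_mat emb (A * B)) = row_mult (row_mult c (map_mat emb A)) (map_mat emb B)"
    if "c \<in> C" for c
    using that A B C row_mult_mult[of c n "map_mat emb A" n "map_mat emb B" n] by (auto simp: mat_hom_mult)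
  then have "E = (\<lambda>c. row_mult c (map_mat emb (A * B))) ` C"
    unfolding A B image_image by simp
  then show ?thesis
    using A B invertible_mat_mult[of A n B] unfolding code_equiv_def by (intro bexI[of _ "A * B"]) auto
qed

subsection \<open>Rank weights\<close>

context field_ext
begin

lemma rank_weight_eq: "rank_weight emb v = ext_dim emb (set\<^sub>v v)"
  by (simp add: rank_weight_def)

lemma vec_set_row_mult:
  assumes "c \<in> carrier_vec n" "A \<in> carrier_mat n n'"
  shows "set\<^sub>v (row_mult c (map_mat emb A)) \<subseteq> ext_span emb (set\<^sub>v c)"
proof
  fix x assume "x \<in> set\<^sub>v (row_mult c (map_mat emb A))"
  then obtain j where j: "j < n'" "x = row_mult c (map_mat emb A) $ j"
    using assms by (auto simp: vec_set_def)
  then have "x = (\<Sum>i<n. ext_scale emb (A $$ (i, j)) (c $ i))"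
    using assms row_mult_index[of c n "map_mat emb A" n' j] by (simp add: ext_scale_def)
  also have "\<dots> \<in> ext_span emb (set\<^sub>v c)"
    using assms by (intro E.span_sum E.span_scale E.span_base) (auto simp: vec_set_def)
  finally show "x \<in> ext_span emb (set\<^sub>v c)" .
qed

text \<open>The inclusion of \<open>vec_set_row_mult\<close> is applied to \<open>A\<close> and to
  its inverse.\<close>

lemma span_row_mult:
  assumes c: "c \<in> carrier_vec n" and A: "A \<in> carrier_mat n n" "invertible_mat A"
  shows "ext_span emb (set\<^sub>v (row_mult c (map_mat emb A))) = ext_span emb (set\<^sub>v c)"
proof -
  obtain B where B: "B \<in> carrier_mat n n" "A * B = 1\<^sub>m n" using invertible_matE[OF A(2,1)] .
  have "c = row_mult c (map_mat emb (A * B))" using B c by (simp add: mat_hom_one row_mult_one)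
  also have "\<dots> = row_mult (row_mult c (map_mat emb A)) (map_mat emb B)"
    unfolding mat_hom_mult[OF A(1) B(1)] by (rule row_mult_mult) (use c A B in auto)
  finally have "set\<^sub>v c \<subseteq> ext_span emb (set\<^sub>v (row_mult c (map_mat emb A)))"
    using vec_set_row_mult[of "row_mult c (map_mat emb A)" n B n] A B by simp
  then show ?thesis
    using vec_set_row_mult[OF c A(1)] by (simp add: E.span_eq)
qed

lemma rank_weight_row_mult:
  "c \<in> carrier_vec n \<Longrightarrow> A \<in> carrier_mat n n \<Longrightarrow> invertible_mat A \<Longrightarrow>
    rank_weight emb (row_mult c (map_mat emb A)) = rank_weight emb c"
  by (simp add: rank_weight_def span_row_mult)

lemma weight_count_code_equiv:
  assumes C: "C \<subseteq> carrier_vec n" and "code_equiv emb n C D"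
  shows "weight_count emb i D = weight_count emb i C"
proof -
  obtain A where A: "A \<in> carrier_mat n n" "invertible_mat A" and D: "D = (\<lambda>c. row_mult c (map_mat emb A)) ` C"
    using assms by (auto simp: code_equiv_def)
  let ?T = "\<lambda>c. row_mult c (map_mat emb A)"
  have "{c \<in> D. rank_weight emb c = i} = ?T ` {c \<in> C. rank_weight emb c = i}"
    using C rank_weight_row_mult[OF _ A] by (auto simp: D)
  moreover have "inj_on ?T {c \<in> C. rank_weight emb c = i}"
    using inj_on_row_mult[OF invertible_map_mat[OF A(2,1)]] A C
    by (metis (mono_tags, lifting) inj_on_subset map_carrier_mat mem_Collect_eq subset_iff)
  ultimately show ?thesis by (simp add: weight_count_def card_image)
qed

section \<open>Multiples of a subspace by elements of the extension field\<close>

lemma span_times: "ext_span emb ((*) a ` S) = (*) a ` ext_span emb S"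
proof -
  interpret module_hom "ext_scale emb" "ext_scale emb" "(*) a"
    by unfold_locales (auto simp: ext_scale_def algebra_simps)
  show ?thesis using span_image[of S] by (simp add: ext_span_def)
qed

lemma inj_times: "a \<noteq> 0 \<Longrightarrow> inj_on ((*) a) (S :: 'e set)"
  by (auto simp: inj_on_def)

lemma dim_times: "a \<noteq> 0 \<Longrightarrow> ext_dim emb ((*) a ` S) = ext_dim emb S"
  using card_span[of "(*) a ` S"] card_span[of S] q_ge_2
  by (simp add: span_times card_image[OF inj_times])

lemma subspace_times: "E.subspace U \<Longrightarrow> E.subspace ((*) a ` U)"
  by (metis E.span_eq_iff span_times)

lemma times_subset_iff:
  assumes "E.subspace U" "E.subspace V" "ext_dim emb U = ext_dim emb V" "y \<noteq> 0" "x \<noteq> 0"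
  shows "(*) y ` U \<subseteq> (*) x ` V \<longleftrightarrow> (*) y ` U = (*) x ` V"
proof
  assume "(*) y ` U \<subseteq> (*) x ` V"
  then have "ext_span emb ((*) y ` U) = ext_span emb ((*) x ` V)"
    using assms E.span_superset[of "(*) x ` V"] by (intro span_eqI_dim) (auto simp: dim_times)
  moreover have "ext_span emb ((*) y ` U) = (*) y ` U" "ext_span emb ((*) x ` V) = (*) x ` V"
    using assms by (simp_all add: subspace_times)
  ultimately show "(*) y ` U = (*) x ` V" by simp
qed simp

definition similar_spaces :: "'e set \<Rightarrow> 'e set \<Rightarrow> bool" where
  "similar_spaces U V \<longleftrightarrow> (\<exists>b. b \<noteq> 0 \<and> (*) b ` U = V)"

lemma similar_spaces_refl: "similar_spaces U U"
  unfolding similar_spaces_def by (intro exI[of _ 1]) auto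

lemma times_image_times: "(*) a ` (*) b ` (S :: 'e set) = (*) (a * b) ` S"
  by (simp add: image_image mult.assoc)

lemma times_image_inverse: "a \<noteq> 0 \<Longrightarrow> (*) a ` S = T \<longleftrightarrow> S = (*) (inverse a) ` (T :: 'e set)"
proof -
  assume "a \<noteq> 0"
  have one: "(*) 1 ` X = X" for X :: "'e set" by auto
  have "(*) (inverse a) ` (*) a ` S = S" "(*) a ` (*) (inverse a) ` T = T"
    unfolding times_image_times using \<open>a \<noteq> 0\<close> one by simp_all
  then show ?thesis by blast
qed

text \<open>Together with reflexivity, this form yields both symmetry and transitivity of the
  relation.\<close>

lemma similar_spaces_euclidean:
  assumes "similar_spaces U W" "similar_spaces V W"
  shows "similar_spaces U V"
proof -
  obtain a b where ab: "a \<noteq> 0" "b \<noteq> 0" "(*) a ` U = W" "(*) b ` V = W"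
    using assms by (auto simp: similar_spaces_def)
  then have "V = (*) (inverse b) ` (*) a ` U" using times_image_inverse[of b V W] by simp
  then show ?thesis
    unfolding similar_spaces_def times_image_times using ab by (intro exI[of _ "inverse b * a"]) auto
qed

lemma similar_spaces_dim: "similar_spaces U V \<Longrightarrow> ext_dim emb U = ext_dim emb V"
  by (auto simp: similar_spaces_def dim_times)

text \<open>The multiplier 0 always qualifies. If a nonzero \<open>y\<close> does, the bound on the
  dimension of \<open>V\<close> turns the inclusion into an equality, and all solutions are
  \<open>y\<close> times a multiplier of \<open>U\<close>. Those multipliers form the ground field,
  which gives \<open>q\<close> solutions.\<close>

lemma card_transporter:
  assumes m: "prime m" and U: "E.subspace U" and V: "E.subspace V"
    and pos: "0 < ext_dim emb U" and lt: "ext_dim emb U < m"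
    and le: "ext_dim emb V \<le> ext_dim emb U" and x: "x \<noteq> 0"
  shows "card {y. (*) y ` U \<subseteq> (*) x ` V} = (if similar_spaces U V then CARD('f) else 1)"
proof (cases "\<exists>y. y \<noteq> 0 \<and> (*) y ` U \<subseteq> (*) x ` V")
  case True
  then obtain y where y: "y \<noteq> 0" "(*) y ` U \<subseteq> (*) x ` V" by blast
  then have "ext_dim emb U \<le> ext_dim emb V"
    using dim_mono[of "(*) y ` U" "(*) x ` V"] E.span_superset[of "(*) x ` V"] x by (auto simp: dim_times)
  then have eq: "(*) y ` U = (*) x ` V" using times_subset_iff[OF U V _ y(1) x] y(2) le by simp
  have "V = (*) (inverse x) ` (*) y ` U"
    using times_image_inverse[of x V "(*) y ` U"] x eq by blast
  then have sim: "similar_spaces U V"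
    unfolding similar_spaces_def times_image_times using x y(1)
    by (intro exI[of _ "inverse x * y"]) auto
  have "{z. (*) z ` U \<subseteq> (*) x ` V} = (*) y ` {c. \<forall>u\<in>U. c * u \<in> U}"
  proof safe
    fix z assume z: "(*) z ` U \<subseteq> (*) x ` V"
    have "z / y * u \<in> U" if "u \<in> U" for u
    proof -
      have "z * u \<in> (*) y ` U" unfolding eq by (rule subsetD[OF z imageI[OF that]])
      then obtain v where "v \<in> U" "z * u = y * v" by (rule imageE)
      then show ?thesis using y by (simp add: field_simps)
    qed
    then show "z \<in> (*) y ` {c. \<forall>u\<in>U. c * u \<in> U}"
      using y by (intro image_eqI[where x = "z / y"]) auto
  next
    fix c u assume "\<forall>u\<in>U. c * u \<in> U" "u \<in> U"
    then have "y * (c * u) \<in> (*) y ` U" by (intro imageI) auto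
    then show "y * c * u \<in> (*) x ` V" by (simp only: eq mult.assoc)
  qed
  then show ?thesis
    using sim y stabilizer_eq_range[OF m U pos lt] by (simp add: card_image inj_times inj_f)
next
  case False
  have "\<not> similar_spaces U V"
  proof
    assume "similar_spaces U V"
    then obtain b where "b \<noteq> 0" "(*) b ` U = V" by (auto simp: similar_spaces_def)
    then have "x * b \<noteq> 0 \<and> (*) (x * b) ` U \<subseteq> (*) x ` V"
      using x by (auto simp: times_image_times[symmetric])
    then show False using False by blast
  qed
  moreover have "0 \<in> (*) x ` V" using E.subspace_0[OF V] by (intro image_eqI[where x = 0]) auto
  then have "{y. (*) y ` U \<subseteq> (*) x ` V} = {0}" using False by auto
  ultimately show ?thesis by simp
qed

end

subsection \<open>Words of minimal weight\<close>

text \<open>Only the blocks and their lengths are fixed, not a code, so the results apply to every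
  weight complementary form of every equivalent code. The last \<open>l + 1\<close> blocks are
  exactly those of minimal length.\<close>

locale block_code = field_ext emb m
  for emb :: "'f :: {field, finite} \<Rightarrow> 'e :: {field, finite}" and m :: nat +
  fixes k l :: nat and nn :: "nat \<Rightarrow> nat" and us :: "nat \<Rightarrow> 'e vec"
  assumes prime_m: "prime m" and l_less: "l < k"
    and block_carrier: "i \<in> {1..k} \<Longrightarrow> us i \<in> carrier_vec (nn i)"
    and block_weight: "i \<in> {1..k} \<Longrightarrow> rank_weight emb (us i) = nn i"
    and nn_pos: "i \<in> {1..k} \<Longrightarrow> 0 < nn i" and nn_less: "i \<in> {1..k} \<Longrightarrow> nn i < m"
    and nn_eq: "i \<in> {k - l..k} \<Longrightarrow> nn i = nn k"
    and nn_gt: "i \<in> {1..<k - l} \<Longrightarrow> nn k < nn i"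
begin

abbreviation U :: "nat \<Rightarrow> 'e set" where "U i \<equiv> ext_span emb (set\<^sub>v (us i))"

definition word :: "(nat \<Rightarrow> 'e) \<Rightarrow> 'e vec" where
  "word a = concat_vec (map (\<lambda>i. a i \<cdot>\<^sub>v us i) [1..<k+1])"

lemma dim_block: "i \<in> {1..k} \<Longrightarrow> ext_dim emb (set\<^sub>v (us i)) = nn i"
  using block_weight[of i] by (simp add: rank_weight_eq)

lemma nn_ge: "i \<in> {1..k} \<Longrightarrow> nn k \<le> nn i"
  using nn_eq[of i] nn_gt[of i] by (cases "i < k - l") auto

lemma vec_set_word: "set\<^sub>v (word a) = (\<Union>i\<in>{1..k}. (*) (a i) ` set\<^sub>v (us i))"
  by (auto simp: word_def vec_set_concat vec_set_smult atLeastLessThanSuc_atLeastAtMost simp del: upt_Suc)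

text \<open>The entries of a word span the sum of all \<open>a i U i\<close>. This contains
  \<open>a j U j\<close>, of dimension \<open>nn j\<close>, and has the same dimension exactly when
  every summand lies inside it.\<close>

lemma rank_weight_word:
  assumes j: "j \<in> {1..k}" and aj: "a j \<noteq> 0"
  shows "nn j \<le> rank_weight emb (word a)"
    and "rank_weight emb (word a) = nn j \<longleftrightarrow> (\<forall>i\<in>{1..k}. (*) (a i) ` U i \<subseteq> (*) (a j) ` U j)"
proof -
  let ?X = "set\<^sub>v (word a)" and ?Y = "(*) (a j) ` set\<^sub>v (us j)"
  have Y: "ext_dim emb ?Y = nn j" using aj block_weight[OF j] by (simp add: dim_times rank_weight_eq)
  have YX: "?Y \<subseteq> ?X" using j unfolding vec_set_word by blast
  have YX': "?Y \<subseteq> ext_span emb ?X" using YX E.span_superset by blast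
  show "nn j \<le> rank_weight emb (word a)"
    using dim_mono[OF YX'] Y by (simp add: rank_weight_eq)
  show "rank_weight emb (word a) = nn j \<longleftrightarrow> (\<forall>i\<in>{1..k}. (*) (a i) ` U i \<subseteq> (*) (a j) ` U j)"
  proof
    assume "rank_weight emb (word a) = nn j"
    then have "ext_span emb ?Y = ext_span emb ?X"
      using YX' Y by (intro span_eqI_dim) (auto simp: rank_weight_eq)
    then have eq: "(*) (a j) ` U j = ext_span emb ?X" by (simp add: span_times)
    show "\<forall>i\<in>{1..k}. (*) (a i) ` U i \<subseteq> (*) (a j) ` U j"
    proof
      fix i assume "i \<in> {1..k}"
      then have "(*) (a i) ` set\<^sub>v (us i) \<subseteq> ?X" unfolding vec_set_word by blast
      then have "(*) (a i) ` U i \<subseteq> ext_span emb ?X" using E.span_mono by (metis span_times)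
      then show "(*) (a i) ` U i \<subseteq> (*) (a j) ` U j" unfolding eq .
    qed
  next
    assume sub: "\<forall>i\<in>{1..k}. (*) (a i) ` U i \<subseteq> (*) (a j) ` U j"
    have "?X \<subseteq> (*) (a j) ` U j"
      unfolding vec_set_word using sub E.span_superset by (intro UN_least) blast
    then have "ext_dim emb ?X \<le> ext_dim emb ?Y"
      by (intro dim_mono) (simp add: span_times)
    then show "rank_weight emb (word a) = nn j"
      using dim_mono[OF YX'] Y by (simp add: rank_weight_eq)
  qed
qed

lemma block_nonzero: "i \<in> {1..k} \<Longrightarrow> \<exists>t<dim_vec (us i). us i $ t \<noteq> 0"
proof (rule ccontr)
  assume i: "i \<in> {1..k}" and "\<not> ?thesis"
  then have "set\<^sub>v (us i) \<subseteq> ext_span emb {}" by (auto simp: vec_set_def)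
  then have "ext_dim emb (set\<^sub>v (us i)) \<le> ext_dim emb {}" by (rule dim_mono)
  then show False
    using block_weight[OF i] nn_pos[OF i] E.dim_eq_card_independent[OF E.independent_empty]
    by (simp add: rank_weight_eq)
qed

text \<open>Each block has a nonzero entry, from which its coefficient is recovered. Counting words
  thus becomes counting extensional coefficient functions.\<close>

lemma inj_word: "inj_on word ({1..k} \<rightarrow>\<^sub>E UNIV)"
proof (rule inj_onI)
  fix a b assume ab: "a \<in> {1..k} \<rightarrow>\<^sub>E (UNIV :: 'e set)" "b \<in> {1..k} \<rightarrow>\<^sub>E (UNIV :: 'e set)" "word a = word b"
  show "a = b"
  proof (rule PiE_ext[OF ab(1,2)])
    fix i assume i: "i \<in> {1..k}"
    then have "a i \<cdot>\<^sub>v us i = b i \<cdot>\<^sub>v us i"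
      using ab(3) unfolding word_def
      by (intro concat_vec_inject[of "[1..<k+1]" "\<lambda>i. a i \<cdot>\<^sub>v us i" "\<lambda>i. b i \<cdot>\<^sub>v us i"]) auto
    moreover obtain t where "t < dim_vec (us i)" "us i $ t \<noteq> 0" using block_nonzero[OF i] by blast
    ultimately show "a i = b i" by (metis index_smult_vec(1) mult_right_cancel)
  qed
qed

lemma punctured_eq_word_image: "punctured k us 1 = word ` ({1..k} \<rightarrow>\<^sub>E UNIV)"
proof -
  have "word a = word (restrict a {1..k})" for a
    unfolding word_def by (intro arg_cong[of _ _ concat_vec] map_cong) auto
  then have mem: "word a \<in> word ` ({1..k} \<rightarrow>\<^sub>E UNIV)" for a
    by (intro image_eqI[where x = "restrict a {1..k}"]) auto
  have punc: "punctured k us 1 = {word a | a. True}" by (simp only: punctured_def word_def)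
  show ?thesis
  proof (intro equalityI subsetI)
    fix c assume "c \<in> punctured k us 1"
    then obtain a where "c = word a" unfolding punc by auto
    then show "c \<in> word ` ({1..k} \<rightarrow>\<^sub>E UNIV)" using mem[of a] by simp
  next
    fix c assume "c \<in> word ` ({1..k} \<rightarrow>\<^sub>E (UNIV :: 'e set))"
    then obtain a where "c = word a" by (rule imageE)
    then show "c \<in> punctured k us 1" unfolding punc by auto
  qed
qed

text \<open>The minimal words are sorted by the last index \<open>j\<close> with a nonzero
  coefficient. Inclusions are demanded only below \<open>j\<close>, since the zero coefficients
  above \<open>j\<close> satisfy them trivially.\<close>

definition leading_at :: "nat \<Rightarrow> (nat \<Rightarrow> 'e) set" where
  "leading_at j = {a \<in> {1..k} \<rightarrow>\<^sub>E UNIV. a j \<noteq> 0 \<and> (\<forall>i\<in>{j<..k}. a i = 0) \<and>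
     (\<forall>i\<in>{1..<j}. (*) (a i) ` U i \<subseteq> (*) (a j) ` U j)}"

lemma minimum_weight_words:
  "{a \<in> {1..k} \<rightarrow>\<^sub>E UNIV. rank_weight emb (word a) = nn k} = (\<Union>j\<in>{k - l..k}. leading_at j)"
proof (intro equalityI subsetI)
  fix a assume "a \<in> {a \<in> {1..k} \<rightarrow>\<^sub>E UNIV. rank_weight emb (word a) = nn k}"
  then have a: "a \<in> {1..k} \<rightarrow>\<^sub>E (UNIV :: 'e set)" and w: "rank_weight emb (word a) = nn k"
    by simp_all
  define J where "J = {i \<in> {1..k}. a i \<noteq> 0}"
  \<comment> \<open>The zero word has weight 0, whereas \<open>nn k\<close> is positive.\<close>
  have "J \<noteq> {}"
  proof
    assume "J = {}"
    then have "set\<^sub>v (word a) \<subseteq> ext_span emb {}" unfolding vec_set_word by (auto simp: J_def)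
    then have "ext_dim emb (set\<^sub>v (word a)) \<le> ext_dim emb {}" by (rule dim_mono)
    then show False
      using w nn_pos[of k] l_less E.dim_eq_card_independent[OF E.independent_empty] by (simp add: rank_weight_eq)
  qed
  moreover have "finite J" by (simp add: J_def)
  ultimately have j: "Max J \<in> J" "\<And>i. i \<in> J \<Longrightarrow> i \<le> Max J" by auto
  let ?j = "Max J"
  have jk: "?j \<in> {1..k}" "a ?j \<noteq> 0" using j(1) by (auto simp: J_def)
  \<comment> \<open>The last nonzero block alone forces weight at least \<open>nn ?j\<close>, which
    is at least \<open>nn k\<close>; minimality makes both bounds sharp and so places
    \<open>?j\<close> among the last \<open>l + 1\<close> indices.\<close>
  have eq: "nn ?j = nn k" using rank_weight_word(1)[of _ a, OF jk] nn_ge[OF jk(1)] w by simp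
  then have "?j \<in> {k - l..k}" using nn_gt[of ?j] jk(1) by (cases "?j < k - l") auto
  moreover have sub: "\<forall>i\<in>{1..k}. (*) (a i) ` U i \<subseteq> (*) (a ?j) ` U ?j"
    using rank_weight_word(2)[of _ a, OF jk] w eq by simp
  have "a \<in> leading_at ?j"
    unfolding leading_at_def mem_Collect_eq
  proof (intro conjI ballI)
    fix i assume i: "i \<in> {?j<..k}"
    then have "i \<notin> J" using j(2)[of i] by auto
    then show "a i = 0" using i by (simp add: J_def)
  next
    fix i assume "i \<in> {1..<?j}"
    then show "(*) (a i) ` U i \<subseteq> (*) (a ?j) ` U ?j" using jk(1) by (intro bspec[OF sub]) auto
  qed (use a jk in auto)
  ultimately show "a \<in> (\<Union>j\<in>{k - l..k}. leading_at j)" by blast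
next
  fix a assume "a \<in> (\<Union>j\<in>{k - l..k}. leading_at j)"
  then obtain j where j: "j \<in> {k - l..k}" and a: "a \<in> leading_at j" by blast
  then have jk: "j \<in> {1..k}" "a j \<noteq> 0" using l_less by (auto simp: leading_at_def)
  have "(*) (a i) ` U i \<subseteq> (*) (a j) ` U j" if "i \<in> {1..k}" for i
  proof (cases i j rule: linorder_cases)
    case greater
    have "0 \<in> (*) (a j) ` U j" using E.span_zero by (intro image_eqI[where x = 0]) auto
    then show ?thesis using greater a that by (auto simp: leading_at_def)
  qed (use a that in \<open>auto simp: leading_at_def\<close>)
  then have "rank_weight emb (word a) = nn k"
    using rank_weight_word(2)[of _ a, OF jk] nn_eq[OF j] by simp
  then show "a \<in> {a \<in> {1..k} \<rightarrow>\<^sub>E UNIV. rank_weight emb (word a) = nn k}"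
    using a by (simp add: leading_at_def)
qed

text \<open>Once the nonzero coefficient \<open>x\<close> at \<open>j\<close> is chosen, the earlier
  ones are independent of each other: each has \<open>q\<close> choices for a similar space and one
  choice otherwise.\<close>

lemma card_leading_at:
  assumes j: "j \<in> {k - l..k}"
  shows "card (leading_at j) = (CARD('e) - 1) * CARD('f) ^ card {i \<in> {1..<j}. similar_spaces (U i) (U j)}"
proof -
  let ?S = "\<lambda>x. PiE {1..<j} (\<lambda>i. {y. (*) y ` U i \<subseteq> (*) x ` U j})"
  have jk: "j \<in> {1..k}" using j l_less by auto
  \<comment> \<open>A coefficient function is cut into its value at \<open>j\<close> and its
    restriction below \<open>j\<close>; above \<open>j\<close> it is zero.\<close>
  have "bij_betw (\<lambda>(x, b). \<lambda>i\<in>{1..k}. if i < j then b i else if i = j then x else 0)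
      (Sigma (UNIV - {0}) ?S) (leading_at j)"
  proof (rule bij_betwI[where g = "\<lambda>a. (a j, restrict a {1..<j})"])
    show "(\<lambda>(x, b). \<lambda>i\<in>{1..k}. if i < j then b i else if i = j then x else 0)
        \<in> Sigma (UNIV - {0}) ?S \<rightarrow> leading_at j"
      using jk by (auto simp: leading_at_def PiE_iff image_subset_iff)
    show "(\<lambda>a. (a j, restrict a {1..<j})) \<in> leading_at j \<rightarrow> Sigma (UNIV - {0}) ?S"
      by (auto simp: leading_at_def)
    fix p assume "p \<in> Sigma (UNIV - {0}) ?S"
    then obtain x b where p: "p = (x, b)" "b \<in> ?S x" by auto
    have "restrict (\<lambda>i\<in>{1..k}. if i < j then b i else if i = j then x else 0) {1..<j} = b"
      using jk p(2) by (intro ext) (auto simp: restrict_def PiE_iff extensional_def)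
    then show "(\<lambda>a. (a j, restrict a {1..<j})) ((\<lambda>(x, b). \<lambda>i\<in>{1..k}. if i < j then b i else if i = j then x else 0) p) = p"
      using p jk by simp
  next
    fix a assume "a \<in> leading_at j"
    then show "(\<lambda>(x, b). \<lambda>i\<in>{1..k}. if i < j then b i else if i = j then x else 0) (a j, restrict a {1..<j}) = a"
      using jk by (intro ext) (auto simp: leading_at_def restrict_def PiE_iff extensional_def)
  qed
  then have "card (leading_at j) = card (Sigma (UNIV - {0}) ?S)" by (simp add: bij_betw_same_card)
  also have "\<dots> = (\<Sum>x\<in>UNIV - {0}. card (?S x))" by (intro card_SigmaI) (auto intro: finite_PiE)
  also have "\<dots> = (\<Sum>x\<in>UNIV - {0 :: 'e}. CARD('f) ^ card {i \<in> {1..<j}. similar_spaces (U i) (U j)})"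
  proof (intro sum.cong refl)
    fix x :: 'e assume "x \<in> UNIV - {0}"
    then have "card {y. (*) y ` U i \<subseteq> (*) x ` U j} = (if similar_spaces (U i) (U j) then CARD('f) else 1)"
      if "i \<in> {1..<j}" for i
      using that jk nn_pos[of i] nn_less[of i] nn_ge[of i] nn_eq[OF j]
      by (intro card_transporter prime_m E.subspace_span) (auto simp: dim_block)
    then have "card (?S x) = (\<Prod>i\<in>{1..<j}. if similar_spaces (U i) (U j) then CARD('f) else 1)"
      by (simp add: card_PiE)
    also have "\<dots> = CARD('f) ^ card {i \<in> {1..<j}. similar_spaces (U i) (U j)}"
      by (simp add: prod.If_cases Int_def)
    finally show "card (?S x) = CARD('f) ^ card {i \<in> {1..<j}. similar_spaces (U i) (U j)}" .
  qed
  also have "\<dots> = (CARD('e) - 1) * CARD('f) ^ card {i \<in> {1..<j}. similar_spaces (U i) (U j)}"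
    by (simp add: card_Diff_singleton)
  finally show ?thesis .
qed

lemma weight_count_eq:
  "weight_count emb (nn k) (punctured k us 1) =
    (CARD('e) - 1) * (\<Sum>j=k - l..k. CARD('f) ^ card {i \<in> {1..<j}. similar_spaces (U i) (U j)})"
proof -
  have "{c \<in> punctured k us 1. rank_weight emb c = nn k} =
      word ` {a \<in> {1..k} \<rightarrow>\<^sub>E UNIV. rank_weight emb (word a) = nn k}"
    unfolding punctured_eq_word_image by blast
  then have "weight_count emb (nn k) (punctured k us 1) = card (\<Union>j\<in>{k - l..k}. leading_at j)"
    unfolding weight_count_def minimum_weight_words[symmetric]
    by (simp add: card_image inj_on_subset[OF inj_word])
  also have "\<dots> = (\<Sum>j=k - l..k. card (leading_at j))"
  proof (rule card_UN_disjoint)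
    show "\<forall>j\<in>{k - l..k}. finite (leading_at j)"
      unfolding leading_at_def by (auto intro!: finite_subset[OF _ finite_PiE[of "{1..k}" "\<lambda>_. UNIV"]])
    show "\<forall>i\<in>{k - l..k}. \<forall>j\<in>{k - l..k}. i \<noteq> j \<longrightarrow> leading_at i \<inter> leading_at j = {}"
      unfolding leading_at_def by (auto simp: nat_neq_iff)
  qed simp
  also have "\<dots> = (CARD('e) - 1) * (\<Sum>j=k - l..k. CARD('f) ^ card {i \<in> {1..<j}. similar_spaces (U i) (U j)})"
    by (simp add: card_leading_at sum_distrib_left)
  finally show ?thesis .
qed

text \<open>Similar spaces have equal dimension, so only indices from \<open>k - l\<close> on
  contribute to the exponent at \<open>j\<close>, which is therefore at most
  \<open>j - (k - l)\<close>. With these bounds as exponents the sum is the geometric sum of the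
  claim, so equality means that every exponent attains its bound.\<close>

lemma weight_count_maximal_iff:
  "real (weight_count emb (nn k) (punctured k us 1)) =
      (real CARD('f) ^ m - 1) * ((real CARD('f) ^ (l + 1) - 1) / (real CARD('f) - 1)) \<longleftrightarrow>
    (\<forall>i\<in>{k - l..k}. similar_spaces (U i) (U k))"
proof -
  let ?c = "\<lambda>j. card {i \<in> {1..<j}. similar_spaces (U i) (U j)}"
  have q1: "1 < CARD('f)" using q_ge_2 by simp
  have sub: "{i \<in> {1..<j}. similar_spaces (U i) (U j)} \<subseteq> {k - l..<j}" if "j \<in> {k - l..k}" for j
  proof clarify
    fix i assume i: "i \<in> {1..<j}" "similar_spaces (U i) (U j)"
    then have "nn i = nn k" using similar_spaces_dim[OF i(2)] dim_block[of i] dim_block[of j] nn_eq[OF that] that by auto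
    then show "i \<in> {k - l..<j}" using nn_gt[of i] i(1) by (cases "i < k - l") auto
  qed
  have le: "?c j \<le> j - (k - l)" if "j \<in> {k - l..k}" for j
    using card_mono[OF _ sub[OF that]] by simp
  have "(\<Sum>j=k - l..k. CARD('f) ^ (j - (k - l))) = (\<Sum>i<Suc l. CARD('f) ^ i)"
    using l_less by (intro sum.reindex_bij_witness[of _ "\<lambda>i. i + (k - l)" "\<lambda>j. j - (k - l)"]) auto
  then have "real (\<Sum>j=k - l..k. CARD('f) ^ (j - (k - l))) = (\<Sum>i<Suc l. real CARD('f) ^ i)" by simp
  also have "\<dots> = (real CARD('f) ^ (l + 1) - 1) / (real CARD('f) - 1)"
    using q1 by (subst geometric_sum) auto
  finally have geo: "(real CARD('f) ^ (l + 1) - 1) / (real CARD('f) - 1) =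
      real (\<Sum>j=k - l..k. CARD('f) ^ (j - (k - l)))" by simp
  have "1 < CARD('f) ^ m" using q1 m_pos by (rule one_less_power)
  then have "1 < real CARD('f) ^ m" by (metis of_nat_1 of_nat_less_iff of_nat_power)
  then have "real CARD('f) ^ m - 1 \<noteq> 0" by linarith
  moreover have "real (CARD('e) - 1) = real CARD('f) ^ m - 1"
    using \<open>1 < CARD('f) ^ m\<close> by (simp add: card_ext of_nat_diff)
  ultimately have "real (weight_count emb (nn k) (punctured k us 1)) =
      (real CARD('f) ^ m - 1) * ((real CARD('f) ^ (l + 1) - 1) / (real CARD('f) - 1)) \<longleftrightarrow>
      (\<Sum>j=k - l..k. CARD('f) ^ ?c j) = (\<Sum>j=k - l..k. CARD('f) ^ (j - (k - l)))"
    unfolding weight_count_eq geo of_nat_mult by (simp only: mult_cancel_left of_nat_eq_iff) simp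
  also have "\<dots> \<longleftrightarrow> (\<forall>i\<in>{k - l..k}. similar_spaces (U i) (U k))"
  proof
    assume sum_eq: "(\<Sum>j=k - l..k. CARD('f) ^ ?c j) = (\<Sum>j=k - l..k. CARD('f) ^ (j - (k - l)))"
    \<comment> \<open>Equal sums with termwise inequality agree term by term. The term at
      \<open>k\<close> already says that all the spaces in question are similar to
      \<open>U k\<close>.\<close>
    have "CARD('f) ^ ?c k = CARD('f) ^ (k - (k - l))"
      by (rule sum_mono_inv[OF sum_eq]) (use le q1 in auto)
    then have "?c k = card {k - l..<k}" using q1 by simp
    then have "{i \<in> {1..<k}. similar_spaces (U i) (U k)} = {k - l..<k}"
      using sub[of k] by (intro card_subset_eq) auto
    then show "\<forall>i\<in>{k - l..k}. similar_spaces (U i) (U k)"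
      using similar_spaces_refl by (auto simp: set_eq_iff le_less)
  next
    assume sim: "\<forall>i\<in>{k - l..k}. similar_spaces (U i) (U k)"
    show "(\<Sum>j=k - l..k. CARD('f) ^ ?c j) = (\<Sum>j=k - l..k. CARD('f) ^ (j - (k - l)))"
    proof (rule sum.cong)
      fix j assume j: "j \<in> {k - l..k}"
      have "similar_spaces (U i) (U j)" if "i \<in> {k - l..<j}" for i
        using similar_spaces_euclidean[of "U i" "U k" "U j"] sim that j by auto
      then have "{i \<in> {1..<j}. similar_spaces (U i) (U j)} = {k - l..<j}"
        using sub[OF j] l_less by auto
      then show "CARD('f) ^ ?c j = CARD('f) ^ (j - (k - l))" by simp
    qed simp
  qed
  finally show ?thesis .
qed

end

subsection \<open>Change of basis\<close>

context field_ext
begin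

text \<open>Coordinates are indexed by positions in \<open>v\<close> rather than by elements of
  \<open>set\<^sub>v v\<close>, so that they can be used as columns of a matrix.\<close>

lemma span_vec_set:
  "ext_span emb (set\<^sub>v v) = range (\<lambda>c. \<Sum>i<dim_vec v. emb (c i) * v $ i)" (is "_ = range ?f")
proof
  show "ext_span emb (set\<^sub>v v) \<subseteq> range ?f"
  proof (rule E.span_minimal)
    show "set\<^sub>v v \<subseteq> range ?f"
    proof
      fix x assume "x \<in> set\<^sub>v v"
      then obtain j where j: "j < dim_vec v" "x = v $ j" by (auto simp: vec_set_def)
      have "?f (\<lambda>i. of_bool (i = j)) = (\<Sum>i<dim_vec v. if i = j then v $ i else 0)"
        by (intro sum.cong) auto
      then have "x = ?f (\<lambda>i. of_bool (i = j))" using j by simp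
      then show "x \<in> range ?f" by (rule range_eqI[of _ ?f])
    qed
    show "E.subspace (range ?f)"
    proof (rule E.subspaceI)
      have "0 = ?f (\<lambda>_. 0)" by simp
      then show "0 \<in> range ?f" by (rule range_eqI[of _ ?f])
    next
      fix x y assume "x \<in> range ?f" "y \<in> range ?f"
      then obtain c d where "x = ?f c" "y = ?f d" by auto
      then have "x + y = ?f (\<lambda>i. c i + d i)" by (simp add: hom_add distrib_right sum.distrib)
      then show "x + y \<in> range ?f" by (rule range_eqI[of _ ?f])
    next
      fix a x assume "x \<in> range ?f"
      then obtain c where "x = ?f c" by auto
      then have "ext_scale emb a x = ?f (\<lambda>i. a * c i)"
        by (simp add: hom_mult ext_scale_def sum_distrib_left mult.assoc)
      then show "ext_scale emb a x \<in> range ?f" by (rule range_eqI[of _ ?f])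
    qed
  qed
  show "range ?f \<subseteq> ext_span emb (set\<^sub>v v)"
  proof (rule image_subsetI)
    fix c
    have "(\<Sum>i<dim_vec v. ext_scale emb (c i) (v $ i)) \<in> ext_span emb (set\<^sub>v v)"
      by (intro E.span_sum E.span_scale E.span_base) (auto simp: vec_set_def)
    then show "?f c \<in> ext_span emb (set\<^sub>v v)" by (simp only: ext_scale_def)
  qed
qed

text \<open>The coordinate map onto the span is surjective between sets of the same size.\<close>

lemma coordinates_unique:
  assumes dim: "ext_dim emb (set\<^sub>v v) = dim_vec v"
    and eq: "(\<Sum>i<dim_vec v. emb (c i) * v $ i) = (\<Sum>i<dim_vec v. emb (d i) * v $ i)"
    and i: "i < dim_vec v"
  shows "c i = d i"
proof -
  let ?f = "\<lambda>c. \<Sum>i<dim_vec v. emb (c i) * v $ i" and ?P = "{..<dim_vec v} \<rightarrow>\<^sub>E (UNIV :: 'f set)"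
  have restr: "?f (restrict c {..<dim_vec v}) = ?f c" for c by (intro sum.cong) auto
  have mem: "restrict c {..<dim_vec v} \<in> ?P" for c by simp
  have "ext_span emb (set\<^sub>v v) \<subseteq> ?f ` ?P"
  proof
    fix x assume "x \<in> ext_span emb (set\<^sub>v v)"
    then obtain c where "x = ?f c" unfolding span_vec_set by (rule rangeE)
    then have "x = ?f (restrict c {..<dim_vec v})" by (simp only: restr)
    then show "x \<in> ?f ` ?P" using mem by (rule image_eqI[of _ ?f])
  qed
  then have "?f ` ?P = ext_span emb (set\<^sub>v v)" unfolding span_vec_set by (intro equalityI) auto
  then have "card (?f ` ?P) = card ?P" by (simp add: card_span dim card_PiE)
  then have "inj_on ?f ?P" by (intro eq_card_imp_inj_on finite_PiE) auto
  moreover have "?f (restrict c {..<dim_vec v}) = ?f (restrict d {..<dim_vec v})"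
    by (simp only: restr eq)
  ultimately have "restrict c {..<dim_vec v} = restrict d {..<dim_vec v}"
    by (rule inj_onD[of ?f ?P]) (rule mem)+
  from fun_cong[OF this, of i] show ?thesis using i by simp
qed

text \<open>Column \<open>j\<close> of the matrix consists of coordinates of \<open>w $ j\<close>
  with respect to the entries of \<open>v\<close>.\<close>

lemma exists_row_mult:
  assumes v: "v \<in> carrier_vec d" and w: "w \<in> carrier_vec d"
    and sub: "set\<^sub>v w \<subseteq> ext_span emb (set\<^sub>v v)"
  shows "\<exists>A\<in>carrier_mat d d. row_mult v (map_mat emb A) = w"
proof -
  have "\<exists>c. w $ j = (\<Sum>i<d. emb (c i) * v $ i)" if "j < d" for j
  proof -
    have "w $ j \<in> set\<^sub>v w" using w that by (auto simp: vec_set_def)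
    then have "w $ j \<in> range (\<lambda>c. \<Sum>i<d. emb (c i) * v $ i)"
      using sub v unfolding span_vec_set by auto
    then show ?thesis by auto
  qed
  then obtain c where c: "\<And>j. j < d \<Longrightarrow> w $ j = (\<Sum>i<d. emb (c j i) * v $ i)" by metis
  let ?A = "mat d d (\<lambda>(i, j). c j i)"
  have "row_mult v (map_mat emb ?A) = w"
  proof (rule eq_vecI)
    fix j assume "j < dim_vec w"
    then have j: "j < d" using w by simp
    show "row_mult v (map_mat emb ?A) $ j = w $ j"
      using row_mult_index[of v d "map_mat emb ?A" d j] v j c[OF j] by simp
  qed (use w in simp)
  then show ?thesis by (intro bexI[of _ ?A]) auto
qed

text \<open>Matrices \<open>A\<close> and \<open>B\<close> express each vector through the other, so
  \<open>A * B\<close> fixes \<open>v\<close>. The entries of \<open>v\<close> are linearly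
  independent by the dimension assumption, hence \<open>A * B\<close> is the identity.\<close>

lemma exists_change_of_basis:
  assumes v: "v \<in> carrier_vec d" and w: "w \<in> carrier_vec d"
    and dim: "ext_dim emb (set\<^sub>v v) = d"
    and span: "ext_span emb (set\<^sub>v v) = ext_span emb (set\<^sub>v w)"
  shows "\<exists>A\<in>carrier_mat d d. invertible_mat A \<and> row_mult v (map_mat emb A) = w"
proof -
  obtain A where A: "A \<in> carrier_mat d d" "row_mult v (map_mat emb A) = w"
    using exists_row_mult[OF v w] span E.span_superset by auto
  obtain B where B: "B \<in> carrier_mat d d" "row_mult w (map_mat emb B) = v"
    using exists_row_mult[OF w v] span E.span_superset by auto
  have AB: "A * B \<in> carrier_mat d d" using A B by simp
  have v_eq: "row_mult v (map_mat emb (A * B)) = v"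
    unfolding mat_hom_mult[OF A(1) B(1)]
    using row_mult_mult[of v d "map_mat emb A" d "map_mat emb B" d] v A B by simp
  have "A * B = 1\<^sub>m d"
  proof (rule eq_matI)
    fix i j assume "i < dim_row (1\<^sub>m d :: 'f mat)" "j < dim_col (1\<^sub>m d :: 'f mat)"
    then have ij: "i < d" "j < d" by simp_all
    \<comment> \<open>Column \<open>j\<close> of \<open>A * B\<close> and the \<open>j\<close>-th
      unit vector are both coordinates of \<open>v $ j\<close>, so they coincide.\<close>
    have "(\<Sum>i<d. emb ((A * B) $$ (i, j)) * v $ i) = v $ j"
      using row_mult_index[of v d "map_mat emb (A * B)" d j] v AB ij v_eq A(1) B(1) by simp
    also have "\<dots> = (\<Sum>i<d. if i = j then v $ i else 0)" using ij by simp
    also have "\<dots> = (\<Sum>i<d. emb (of_bool (i = j)) * v $ i)" by (intro sum.cong) auto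
    finally have "(A * B) $$ (i, j) = of_bool (i = j)"
      using coordinates_unique[of v "\<lambda>i. (A * B) $$ (i, j)" "\<lambda>i. of_bool (i = j)" i] v dim ij by simp
    then show "(A * B) $$ (i, j) = 1\<^sub>m d $$ (i, j)" using ij by simp
  qed (use AB in auto)
  then have "invertible_mat A"
    using mat_mult_left_right_inverse[OF A(1) B(1)] A B by (intro invertible_matI) auto
  then show ?thesis using A by blast
qed

end

section \<open>Splitting of the punctured code into copies of a line code\<close>

lemma code_direct_sum_replicate_line:
  "code_direct_sum (replicate r (line_code u)) = {concat_vec (map (\<lambda>i. b i \<cdot>\<^sub>v u) [s..<s + r]) | b. True}"
proof safe
  fix c assume "c \<in> code_direct_sum (replicate r (line_code u))"
  then obtain cs where cs: "c = concat_vec cs" "list_all2 (\<in>) cs (replicate r (line_code u))"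
    by (auto simp: code_direct_sum_def)
  then have len: "length cs = r" and "\<forall>t<r. \<exists>b. cs ! t = b \<cdot>\<^sub>v u"
    by (auto simp: list_all2_conv_all_nth line_code_def)
  then obtain b where "\<forall>t<r. cs ! t = b t \<cdot>\<^sub>v u" by metis
  \<comment> \<open>List positions start at 0 and the index range at \<open>s\<close>; the free
    choice of \<open>s\<close> lets the direct sum be compared with a punctured code block by
    block.\<close>
  then have "cs = map (\<lambda>i. b (i - s) \<cdot>\<^sub>v u) [s..<s + r]"
    using len by (intro nth_equalityI) auto
  then show "\<exists>b. c = concat_vec (map (\<lambda>i. b i \<cdot>\<^sub>v u) [s..<s + r]) \<and> True"
    using cs(1) by (intro exI[of _ "\<lambda>i. b (i - s)"]) simp
next
  fix b
  have "list_all2 (\<in>) (map (\<lambda>i. b i \<cdot>\<^sub>v u) [s..<s + r]) (replicate r (line_code u))"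
    by (auto simp: list_all2_conv_all_nth line_code_def)
  then show "concat_vec (map (\<lambda>i. b i \<cdot>\<^sub>v u) [s..<s + r]) \<in> code_direct_sum (replicate r (line_code u))"
    by (auto simp: code_direct_sum_def)
qed

context block_code
begin

text \<open>The word with coefficient 1 at \<open>i\<close> and 0 elsewhere must also be a word of
  the direct sum. Comparing the blocks at \<open>i\<close> shows that \<open>us i\<close> is a
  nonzero multiple of \<open>u\<close>.\<close>

lemma similar_if_punctured_direct_sum:
  assumes u: "u \<in> carrier_vec (nn k)"
    and eq: "punctured k us (k - l) = code_direct_sum (replicate (l + 1) (line_code u))"
    and i: "i \<in> {k - l..k}"
  shows "similar_spaces (ext_span emb (set\<^sub>v u)) (U i)"
proof -
  let ?is = "[k - l..<k + 1]" and ?a = "\<lambda>t. of_bool (t = i) :: 'e"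
  have is_eq: "[k - l..<(k - l) + (l + 1)] = ?is" using l_less by simp
  have i1: "i \<in> {1..k}" using i l_less by auto
  have "concat_vec (map (\<lambda>t. ?a t \<cdot>\<^sub>v us t) ?is) \<in> punctured k us (k - l)"
    unfolding punctured_def by (intro CollectI exI[of _ ?a]) simp
  then obtain b where "concat_vec (map (\<lambda>t. ?a t \<cdot>\<^sub>v us t) ?is) = concat_vec (map (\<lambda>t. b t \<cdot>\<^sub>v u) ?is)"
    unfolding eq code_direct_sum_replicate_line[of _ _ "k - l"] is_eq by blast
  moreover have "dim_vec (?a t \<cdot>\<^sub>v us t) = dim_vec (b t \<cdot>\<^sub>v u)" if "t \<in> set ?is" for t
    using block_carrier[of t] nn_eq[of t] that u l_less by auto
  ultimately have "?a i \<cdot>\<^sub>v us i = b i \<cdot>\<^sub>v u"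
    using i by (intro concat_vec_inject[of ?is "\<lambda>t. ?a t \<cdot>\<^sub>v us t" "\<lambda>t. b t \<cdot>\<^sub>v u" i]) auto
  then have us_i: "us i = b i \<cdot>\<^sub>v u" by simp
  then have "b i \<noteq> 0" using block_nonzero[OF i1] by auto
  moreover have "(*) (b i) ` ext_span emb (set\<^sub>v u) = U i"
    unfolding us_i vec_set_smult span_times ..
  ultimately show ?thesis unfolding similar_spaces_def by blast
qed

text \<open>If \<open>x U i = U k\<close>, then \<open>x\<close> times \<open>us i\<close> and
  \<open>us k\<close> have the same span, so an invertible matrix over the ground field takes one to
  the other. Moving \<open>x\<close> to the other side gives \<open>y i = inverse x\<close>.\<close>

lemma exists_scalar_multiple_blocks:
  assumes sim: "\<And>i. i \<in> {k - l..k} \<Longrightarrow> similar_spaces (U i) (U k)"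
  obtains A y where
    "\<And>i. i \<in> {1..k} \<Longrightarrow> A i \<in> carrier_mat (nn i) (nn i)"
    "\<And>i. i \<in> {1..k} \<Longrightarrow> invertible_mat (A i)"
    "\<And>i. i \<in> {k - l..k} \<Longrightarrow> y i \<noteq> 0"
    "\<And>i. i \<in> {k - l..k} \<Longrightarrow> row_mult (us i) (map_mat emb (A i)) = y i \<cdot>\<^sub>v us k"
proof -
  have "\<exists>A y. A \<in> carrier_mat (nn i) (nn i) \<and> invertible_mat A \<and>
      (i \<in> {k - l..k} \<longrightarrow> y \<noteq> 0 \<and> row_mult (us i) (map_mat emb A) = y \<cdot>\<^sub>v us k)"
    if i: "i \<in> {1..k}" for i
  proof (cases "i \<in> {k - l..k}")
    case True
    obtain x where x: "x \<noteq> 0" "(*) x ` U i = U k"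
      using sim[OF True] by (auto simp: similar_spaces_def)
    have "\<exists>A\<in>carrier_mat (nn i) (nn i). invertible_mat A \<and> row_mult (x \<cdot>\<^sub>v us i) (map_mat emb A) = us k"
    proof (rule exists_change_of_basis)
      show "x \<cdot>\<^sub>v us i \<in> carrier_vec (nn i)" using block_carrier[OF i] by simp
      show "us k \<in> carrier_vec (nn i)" using block_carrier[of k] nn_eq[OF True] l_less by simp
      show "ext_dim emb (set\<^sub>v (x \<cdot>\<^sub>v us i)) = nn i"
        unfolding vec_set_smult dim_times[OF x(1)] by (rule dim_block[OF i])
      show "ext_span emb (set\<^sub>v (x \<cdot>\<^sub>v us i)) = U k"
        unfolding vec_set_smult span_times by (rule x(2))
    qed
    then obtain A where A: "A \<in> carrier_mat (nn i) (nn i)" "invertible_mat A"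
      "row_mult (x \<cdot>\<^sub>v us i) (map_mat emb A) = us k" by blast
    have "x \<cdot>\<^sub>v row_mult (us i) (map_mat emb A) = us k"
      using A block_carrier[OF i] row_mult_smult[of "us i" "nn i" "map_mat emb A" "nn i" x] by simp
    then have "inverse x \<cdot>\<^sub>v (x \<cdot>\<^sub>v row_mult (us i) (map_mat emb A)) = inverse x \<cdot>\<^sub>v us k" by simp
    then have "row_mult (us i) (map_mat emb A) = inverse x \<cdot>\<^sub>v us k"
      using x(1) by (simp add: smult_smult_assoc)
    then show ?thesis using A x(1) by (intro exI[of _ A] exI[of _ "inverse x"]) auto
  next
    case False
    \<comment> \<open>The longer blocks are left unchanged by taking the identity matrix.\<close>
    have "invertible_mat (1\<^sub>m (nn i) :: 'f mat)" by (rule invertible_matI[of _ "nn i" "1\<^sub>m (nn i)"]) auto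
    then show ?thesis using False by (intro exI[of _ "1\<^sub>m (nn i)"]) auto
  qed
  then have "\<exists>A y. \<forall>i\<in>{1..k}. A i \<in> carrier_mat (nn i) (nn i) \<and> invertible_mat (A i) \<and>
      (i \<in> {k - l..k} \<longrightarrow> y i \<noteq> 0 \<and> row_mult (us i) (map_mat emb (A i)) = y i \<cdot>\<^sub>v us k)"
    by metis
  then obtain A y where Ay: "\<forall>i\<in>{1..k}. A i \<in> carrier_mat (nn i) (nn i) \<and> invertible_mat (A i) \<and>
      (i \<in> {k - l..k} \<longrightarrow> y i \<noteq> 0 \<and> row_mult (us i) (map_mat emb (A i)) = y i \<cdot>\<^sub>v us k)"
    by blast
  have "i \<in> {1..k}" if "i \<in> {k - l..k}" for i using that l_less by auto
  then show thesis using Ay by (intro that[of A y]) blast+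
qed

text \<open>A block-diagonal change of basis acts on each block separately and commutes with the
  scalar coefficients; so the image has the transformed blocks as generator, with their weights
  preserved.\<close>

lemma weight_complementary_transform:
  assumes wc: "weight_complementary emb n k nn D us" and n: "n = (\<Sum>i=1..k. nn i)"
    and A: "\<And>i. i \<in> {1..k} \<Longrightarrow> A i \<in> carrier_mat (nn i) (nn i)"
    and inv: "\<And>i. i \<in> {1..k} \<Longrightarrow> invertible_mat (A i)"
  defines "us' \<equiv> \<lambda>i. row_mult (us i) (map_mat emb (A i))"
  shows "\<exists>D'. code_equiv emb n D D' \<and> weight_complementary emb n k nn D' us'"
proof -
  let ?is = "[1..<k + 1]"
  let ?M = "diag_block_mat (map A ?is)"
  have set_is: "i \<in> set ?is \<longleftrightarrow> i \<in> {1..k}" for i by auto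
  have "map dim_row (map A ?is) = map nn ?is" "map dim_col (map A ?is) = map nn ?is"
    using carrier_matD[OF A] by auto
  moreover have "sum_list (map nn ?is) = n"
    by (simp add: n sum_list_distinct_conv_sum_set atLeastLessThanSuc_atLeastAtMost del: upt_Suc)
  ultimately have M: "?M \<in> carrier_mat n n" by (metis carrier_matI dim_diag_block_mat)
  have inv_M: "invertible_mat ?M"
    by (rule invertible_diag_block_mat[where d = nn]) (use A inv set_is in blast)+
  define D' where "D' = (\<lambda>c. row_mult c (map_mat emb ?M)) ` D"
  have gen: "is_code n k D" "D = {row_mult x (block_matrix k us) | x. x \<in> carrier_vec k}"
    using wc by (auto simp: weight_complementary_def generator_matrix_def)
  have code: "is_code n k D'"
    unfolding D'_def using is_code_image[OF gen(1) invertible_map_mat[OF inv_M M]] M by simp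
  have step: "row_mult (concat_vec (map (\<lambda>i. a i \<cdot>\<^sub>v us i) ?is)) (map_mat emb ?M) =
      concat_vec (map (\<lambda>i. a i \<cdot>\<^sub>v us' i) ?is)" for a
  proof -
    have blocks: "dim_vec (a i \<cdot>\<^sub>v us i) = dim_row (map_mat emb (A i))"
      "row_mult (a i \<cdot>\<^sub>v us i) (map_mat emb (A i)) = a i \<cdot>\<^sub>v us' i" if "i \<in> set ?is" for i
      using that A[of i] block_carrier[of i] row_mult_smult[of "us i" "nn i" "map_mat emb (A i)" "nn i"]
      by (auto simp: us'_def)
    have "row_mult (concat_vec (map (\<lambda>i. a i \<cdot>\<^sub>v us i) ?is)) (map_mat emb ?M) =
        concat_vec (map (\<lambda>i. row_mult (a i \<cdot>\<^sub>v us i) (map_mat emb (A i))) ?is)"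
      unfolding map_diag_block_mat[of emb, OF hom_zero]
      by (rule row_mult_diag_block_mat) (rule blocks(1))
    also have "\<dots> = concat_vec (map (\<lambda>i. a i \<cdot>\<^sub>v us' i) ?is)"
      by (intro arg_cong[of _ _ concat_vec] map_cong refl) (rule blocks(2))
    finally show ?thesis .
  qed
  have "D = {concat_vec (map (\<lambda>i. a i \<cdot>\<^sub>v us i) ?is) | a. True}"
    unfolding gen(2) block_code_eq_punctured punctured_def ..
  then have "D' = {concat_vec (map (\<lambda>i. a i \<cdot>\<^sub>v us' i) ?is) | a. True}"
    unfolding D'_def step[symmetric] by blast
  then have D': "D' = {row_mult x (block_matrix k us') | x. x \<in> carrier_vec k}"
    unfolding block_code_eq_punctured punctured_def .
  have us': "us' i \<in> carrier_vec (nn i)" "rank_weight emb (us' i) = nn i" if "i \<in> {1..k}" for i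
    using that A inv block_carrier block_weight rank_weight_row_mult[of "us i" "nn i" "A i"]
      row_mult_carrier[of "map_mat emb (A i)" "nn i" "nn i" "us i"]
    by (auto simp: us'_def)
  have "block_matrix k us' \<in> carrier_mat k n"
    unfolding n by (rule block_matrix_carrier) (rule us'(1))
  then have "weight_complementary emb n k nn D' us'"
    using code D' us' by (simp add: weight_complementary_def generator_matrix_def)
  moreover have "code_equiv emb n D D'" using M inv_M by (auto simp: code_equiv_def D'_def)
  ultimately show ?thesis by blast
qed

end

theorem theorem4p13:
  fixes emb :: "'f :: {field, finite} \<Rightarrow> 'e :: {field, finite}"
    and m n k l :: nat
    and nn :: "nat \<Rightarrow> nat"
    and C :: "'e vec set"
  assumes "field_hom emb"
    and "CARD('e) = CARD('f) ^ m"
    and "prime m"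
    and "completely_decomposable emb m n k nn C"
    and "l \<in> {1..k - 1}"
    and "nn 0 = 0"
    and "\<forall>i\<in>{k - l..k}. nn i = nn k"
    and "nn (k - l - 1) \<noteq> nn k"
  shows "real (weight_count emb (nn k) C) =
           (real CARD('f) ^ m - 1) * ((real CARD('f) ^ (l + 1) - 1) / (real CARD('f) - 1))
         \<longleftrightarrow>
         (\<exists>D us. code_equiv emb n C D \<and> weight_complementary emb n k nn D us \<and>
           (\<exists>u \<in> carrier_vec (nn k).
              punctured k us (k - l) = code_direct_sum (replicate (l + 1) (line_code u)) \<and>
              rank_weight emb u = nn k \<and>
              (let U = ext_span emb (set\<^sub>v u) in
                 ext_dim emb (space_prod emb (trace_perp CARD('f) m U) U) = m - 1)))"
    (is "?count \<longleftrightarrow> ?split")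
proof -
  interpret field_ext emb m
    using assms(1,2) by (simp add: field_ext_def field_ext_axioms_def)
  have l: "l < k" "1 \<le> l" using assms(5) by auto
  have C: "is_code n k C" and nn: "\<And>i. i \<in> {1..k} \<Longrightarrow> 1 \<le> nn i \<and> nn i < m"
    and dec: "\<And>i. i \<in> {1..<k} \<Longrightarrow> nn (i + 1) \<le> nn i" and n: "n = (\<Sum>i=1..k. nn i)"
    using assms(4) by (auto simp: completely_decomposable_def)
  obtain D us where D: "code_equiv emb n C D" and us: "weight_complementary emb n k nn D us"
    using assms(4) by (auto simp: completely_decomposable_def)
  have mono: "nn j \<le> nn i" if "i \<le> j" "1 \<le> i" "j \<le> k" for i j
    using that(1,3)
  proof (induction rule: dec_induct)
    case (step t)
    then show ?case using dec[of t] that(2) by auto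
  qed simp
  \<comment> \<open>For such an \<open>i\<close> the number \<open>k - l - 1\<close> is itself a
    block index, so by monotonicity and the assumed inequality its length exceeds
    \<open>nn k\<close>, and \<open>nn i\<close> is at least that length.\<close>
  have gt: "nn k < nn i" if i: "i \<in> {1..<k - l}" for i
  proof -
    have "nn (k - l - 1) \<le> nn i" "nn (k - l) \<le> nn (k - l - 1)"
      using i l by (auto intro!: mono)
    moreover have "nn (k - l) = nn k" using bspec[OF assms(7), of "k - l"] by simp
    ultimately show ?thesis using assms(8) by linarith
  qed
  have block: "block_code emb m k l nn us" if "weight_complementary emb n k nn D us" for D us
  proof unfold_locales
    fix i
    show "us i \<in> carrier_vec (nn i)" "rank_weight emb (us i) = nn i" "0 < nn i" "nn i < m"
      if "i \<in> {1..k}"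
      using that \<open>weight_complementary emb n k nn D us\<close> nn[OF that]
      by (auto simp: weight_complementary_def)
    show "nn i = nn k" if "i \<in> {k - l..k}" using assms(7) that by (rule bspec)
    show "nn k < nn i" if "i \<in> {1..<k - l}" using that by (rule gt)
  qed (use assms(3) l in auto)
  \<comment> \<open>Stated for an arbitrary form: one direction starts from the given decomposition,
    the other from the form supplied by the splitting.\<close>
  have count_iff: "?count \<longleftrightarrow>
      (\<forall>i\<in>{k - l..k}. similar_spaces (ext_span emb (set\<^sub>v (us i))) (ext_span emb (set\<^sub>v (us k))))"
    if D: "code_equiv emb n C D" and us: "weight_complementary emb n k nn D us" for D us
  proof -
    have "D = punctured k us 1"
      using us by (simp add: weight_complementary_def generator_matrix_def block_code_eq_punctured)
    then have "weight_count emb (nn k) C = weight_count emb (nn k) (punctured k us 1)"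
      using weight_count_code_equiv[OF is_code_carrier[OF C] D] by simp
    then show ?thesis using block_code.weight_count_maximal_iff[OF block[OF us]] by simp
  qed
  show ?thesis
  proof
    interpret B: block_code emb m k l nn us by (rule block[OF us])
    assume ?count
    then have "similar_spaces (B.U i) (B.U k)" if "i \<in> {k - l..k}" for i
      using count_iff[OF D us] that by blast
    then obtain A y where A: "\<And>i. i \<in> {1..k} \<Longrightarrow> A i \<in> carrier_mat (nn i) (nn i)"
      "\<And>i. i \<in> {1..k} \<Longrightarrow> invertible_mat (A i)"
      and y: "\<And>i. i \<in> {k - l..k} \<Longrightarrow> y i \<noteq> 0"
      "\<And>i. i \<in> {k - l..k} \<Longrightarrow> row_mult (us i) (map_mat emb (A i)) = y i \<cdot>\<^sub>v us k"
      using B.exists_scalar_multiple_blocks by blast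
    define us' where "us' = (\<lambda>i. row_mult (us i) (map_mat emb (A i)))"
    obtain D' where D': "code_equiv emb n D D'" "weight_complementary emb n k nn D' us'"
      using B.weight_complementary_transform[OF us n A] unfolding us'_def by blast
    have "code_equiv emb n C D'"
      using code_equiv_trans[OF assms(1) is_code_carrier[OF C] D D'(1)] .
    moreover have "us k \<in> carrier_vec (nn k)" "rank_weight emb (us k) = nn k"
      using B.block_carrier[of k] B.block_weight[of k] l by auto
    moreover have "punctured k us' (k - l) = code_direct_sum (replicate (l + 1) (line_code (us k)))"
    proof -
      let ?is = "[k - l..<k + 1]"
      have is_eq: "[k - l..<(k - l) + (l + 1)] = ?is" using l by simp
      \<comment> \<open>The transformed blocks are nonzero multiples \<open>y i\<close> of
        \<open>us k\<close>. Multiplying and dividing the coefficients by \<open>y i\<close> gives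
        the two inclusions between the punctured code and the direct sum.\<close>
      have 1: "concat_vec (map (\<lambda>i. a i \<cdot>\<^sub>v us' i) ?is) = concat_vec (map (\<lambda>i. (a i * y i) \<cdot>\<^sub>v us k) ?is)" for a
        using y(2) by (intro arg_cong[of _ _ concat_vec] map_cong) (auto simp: us'_def smult_smult_assoc)
      have 2: "concat_vec (map (\<lambda>i. b i \<cdot>\<^sub>v us k) ?is) = concat_vec (map (\<lambda>i. (b i / y i) \<cdot>\<^sub>v us' i) ?is)" for b
        unfolding 1 using y(1) by (intro arg_cong[of _ _ concat_vec] map_cong) auto
      show ?thesis
        unfolding code_direct_sum_replicate_line[of _ _ "k - l"] is_eq punctured_def
      proof safe
        fix a
        show "\<exists>b. concat_vec (map (\<lambda>i. a i \<cdot>\<^sub>v us' i) ?is) = concat_vec (map (\<lambda>i. b i \<cdot>\<^sub>v us k) ?is) \<and> True"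
          unfolding 1 by (intro exI[of _ "\<lambda>i. a i * y i"] conjI refl TrueI)
      next
        fix b
        show "\<exists>a. concat_vec (map (\<lambda>i. b i \<cdot>\<^sub>v us k) ?is) = concat_vec (map (\<lambda>i. a i \<cdot>\<^sub>v us' i) ?is) \<and> True"
          using 2[of b] by (intro exI[of _ "\<lambda>i. b i / y i"]) simp
      qed
    qed
    \<comment> \<open>The dimension condition follows from \<open>0 < nn k < m\<close> and the
      primality of \<open>m\<close>.\<close>
    moreover have "let U = ext_span emb (set\<^sub>v (us k)) in
        ext_dim emb (space_prod emb (trace_perp CARD('f) m U) U) = m - 1"
      unfolding Let_def using nn[of k] l
      by (intro dim_space_prod_trace_perp[OF assms(3) E.subspace_span]) (auto simp: B.dim_block)
    ultimately show ?split using D'(2) by blast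
  next
    assume ?split
    then obtain D us u where D: "code_equiv emb n C D" and us: "weight_complementary emb n k nn D us"
      and u: "u \<in> carrier_vec (nn k)"
        "punctured k us (k - l) = code_direct_sum (replicate (l + 1) (line_code u))"
      by blast
    interpret B: block_code emb m k l nn us by (rule block[OF us])
    let ?W = "ext_span emb (set\<^sub>v u)"
    have sim: "similar_spaces ?W (B.U i)" if "i \<in> {k - l..k}" for i
      by (rule B.similar_if_punctured_direct_sum[OF u that])
    have "similar_spaces (B.U i) (B.U k)" if "i \<in> {k - l..k}" for i
    proof -
      \<comment> \<open>The splitting compares every block with the common vector \<open>u\<close>;
        reversing this relation makes the blocks comparable with each other.\<close>
      have sym: "similar_spaces (B.U j) ?W" if "j \<in> {k - l..k}" for j
        using similar_spaces_euclidean[OF similar_spaces_refl sim[OF that]] .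
      have "similar_spaces (B.U i) ?W" "similar_spaces (B.U k) ?W" using sym that by auto
      then show ?thesis by (rule similar_spaces_euclidean)
    qed
    then show ?count using count_iff[OF D us] by blast
  qed
qed

end
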